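(* Let $k\ge 0$ be an integer. A function $u=\sum_{n=0}^\infty c_nf_n\in C_0(O,\overline{K}_c)$ belongs to $C_0^{k+1}(O,\overline{K}_c)$ if and only if $$q^{nq^k}|c_n|\to 0\quad\text{for } n\to\infty .$$ In this case $$\sup_{t\in O}|\mathfrak D^ku(t)|=\sup_{n\ge k}q^{(n-k)q^k}|c_n|.$$
   Context: Let $\mathbf F_q$ be the finite field with $q=p^\gamma$ elements ($p$ prime, $\gamma\ge 1$), and let $K=\mathbf F_q((x))$ with absolute value $|z|=q^{-n}$ for $z=\sum_{i=n}^\infty\zeta_i x^i$, $\zeta_i\in\mathbf F_q$, $\zeta_n\neq 0$. Let $O=\{z\in K:|z|\le1\}$ and let $\overline{K}_c$ be the completion of an algebraic closure of $K$, with the extended absolute value. A function $u:O\to\overline{K}_c$ is $\mathbf F_q$-linear if $u(t_1+t_2)=u(t_1)+u(t_2)$ and $u(\alpha t)=\alpha u(t)$ for all $t,t_1,t_2\in O$, $\alpha\in\mathbf F_q$. $C_0(O,\overline{K}_c)$ is the Banach space of all continuous $\mathbf F_q$-linear functions $O\to\overline{K}_c$ with the supremum norm. Put $[i]=x^{q^i}-x$, $D_0=1$, $D_i=[i]\,[i-1]^q\cdots[1]^{q^{i-1}}$ for $i\ge1$. The normalized Carlitz polynomials are $f_i(t)=D_i^{-1}e_i(t)$, $i\ge 0$, where $e_0(t)=t$ and $e_i(t)=\prod_{m\in\mathbf F_q[x],\,\deg m<i}(t-m)$ for $i\ge1$ (the product includes $m=0$). It is known that every $u\in C_0(O,\overline{K}_c)$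 has a unique uniformly convergent expansion $u=\sum_{n\ge0}c_nf_n$ with $c_n\in\overline{K}_c$, $c_n\to0$, and $\|u\|=\sup_n|c_n|$; the $c_n$ in the claim are these coefficients. The difference operators are $\Delta^{(0)}=\mathrm{id}$, $(\Delta^{(n)}u)(t)=(\Delta^{(n-1)}u)(xt)-x^{q^{n-1}}(\Delta^{(n-1)}u)(t)$ for $n\ge1$. For $u\in C_0(O,\overline{K}_c)$ put $\mathfrak D^ku(t)=t^{-q^k}(\Delta^{(k)}u)(t)$, $t\in O\setminus\{0\}$. One says $u\in C_0^{k+1}(O,\overline{K}_c)$ if $u\in C_0(O,\overline{K}_c)$ and $\mathfrak D^ku$ can be extended to a continuous function on $O$ (the extension is again denoted $\mathfrak D^ku$). *)

theory Defs
  imports "HOL-Analysis.Analysis" "HOL-Algebra.Algebraic_Closure_Type"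
begin

text \<open>
  \<^typ>\<open>'a fls\<close> with \<^typ>\<open>'a\<close> a finite field is the local field \<open>K = F_q((x))\<close>, where
  \<open>q = CARD('a)\<close> and \<open>x\<close> is \<^const>\<open>fls_X\<close>.
\<close>

definition fls_abs :: "'a::{field,finite} fls \<Rightarrow> real" where
  "fls_abs z = (if z = 0 then 0 else real CARD('a) powi (- fls_subdegree z))"

definition fls_integers :: "'a::{field,finite} fls set" where
  "fls_integers = {z. fls_abs z \<le> 1}"

text \<open>
  The library metric on \<^typ>\<open>'a fls\<close> uses base \<open>2\<close> in place of base \<open>q\<close>. Both define the
  same topology, so continuity on \<^const>\<open>fls_integers\<close> may refer to the library topology.
\<close>

lemma one_less_card_field: "1 < CARD('a::{field,finite})"
proof -
  have "card {0, 1::'a} \<le> CARD('a)"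
    by (rule card_mono) auto
  then show ?thesis by simp
qed

lemma dist_fls_less_iff_fls_abs_less:
  fixes a b :: "'a::{field,finite} fls"
  shows "dist a b < 2 powi (- n) \<longleftrightarrow> fls_abs (a - b) < real CARD('a) powi (- n)"
proof (cases "a = b")
  case True
  then show ?thesis using one_less_card_field[where 'a = 'a]
    by (simp add: fls_abs_def)
next
  case False
  have mono: "r powi (- m) < r powi (- n) \<longleftrightarrow> n < m" if "1 < r" for r :: real and m
    using that power_int_strict_increasing[of "-m" "-n" r]
      power_int_increasing[of "-n" "-m" r] by fastforce
  have "dist a b = 2 powi (- fls_subdegree (a - b))"
    using False by (auto simp: dist_fls_def power_int_def field_simps)
  then show ?thesis
    using False mono[of 2] mono[of "real CARD('a)"] one_less_card_field[where 'a = 'a]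
    by (simp add: fls_abs_def)
qed

lemma open_fls_iff_fls_abs:
  fixes S :: "'a::{field,finite} fls set"
  shows "open S \<longleftrightarrow> (\<forall>z\<in>S. \<exists>e>0. \<forall>w. fls_abs (w - z) < e \<longrightarrow> w \<in> S)"
proof -
  have small: "\<exists>n. r powi (- n) < e" if r: "1 < r" "0 < e" for r e :: real
  proof -
    obtain n where "inverse r ^ n < e"
      using r real_arch_pow_inv[of e "inverse r"] inverse_less_1_iff[of r] by blast
    then have "r powi (- int n) < e"
      by (simp add: power_int_minus power_inverse)
    then show ?thesis by blast
  qed
  have "(\<exists>e>0. \<forall>w. dist w z < e \<longrightarrow> w \<in> S) \<longleftrightarrow> (\<exists>e>0. \<forall>w. fls_abs (w - z) < e \<longrightarrow> w \<in> S)"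
    (is "?L \<longleftrightarrow> ?R") for z
  proof
    assume ?L
    then obtain e where e: "0 < e" "\<And>w. dist w z < e \<Longrightarrow> w \<in> S" by blast
    obtain n where "(2::real) powi (- n) < e" using small[of 2 e] e by auto
    then have "\<forall>w. fls_abs (w - z) < real CARD('a) powi (- n) \<longrightarrow> w \<in> S"
      using e(2) dist_fls_less_iff_fls_abs_less by (metis order_less_trans)
    then show ?R using one_less_card_field[where 'a = 'a]
      by (intro exI[of _ "real CARD('a) powi (- n)"]) auto
  next
    assume ?R
    then obtain e where e: "0 < e" "\<And>w. fls_abs (w - z) < e \<Longrightarrow> w \<in> S" by blast
    obtain n where "real CARD('a) powi (- n) < e"
      using small[of "real CARD('a)" e] e one_less_card_field[where 'a = 'a] by auto
    then have "\<forall>w. dist w z < 2 powi (- n) \<longrightarrow> w \<in> S"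
      using e(2) dist_fls_less_iff_fls_abs_less by (metis order_less_trans)
    then show ?L by (intro exI[of _ "2 powi (- n)"]) auto
  qed
  then show ?thesis by (simp add: open_dist)
qed

text \<open>
  The completion of the algebraic closure of \<open>K\<close>: a field, complete for the metric induced by
  an absolute value \<open>abv\<close>, in which \<^typ>\<open>'a fls alg_closure\<close> embeds as a dense subfield,
  such that \<open>abv\<close> extends \<^const>\<open>fls_abs\<close>. Definiteness and the triangle inequality of
  \<open>abv\<close> are those of the metric. These conditions determine the valued field up to isometric
  isomorphism over \<open>K\<close>, because the absolute value of the complete field \<open>K\<close> extends
  uniquely to its algebraic closure.
\<close>

locale completed_alg_closure =
  fixes \<iota> :: "'a::{field,finite} fls alg_closure \<Rightarrow> 'c::{field,complete_space}"
    and abv :: "'c \<Rightarrow> real"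
  assumes hom_one: "\<iota> 1 = 1"
    and hom_add: "\<iota> (y + z) = \<iota> y + \<iota> z"
    and hom_mult: "\<iota> (y * z) = \<iota> y * \<iota> z"
    and dense: "closure (range \<iota>) = UNIV"
    and dist_abv: "dist a b = abv (a - b)"
    and abv_mult: "abv (a * b) = abv a * abv b"
    and abv_extends: "abv (\<iota> (to_ac w)) = fls_abs w"

definition emb ::
    "('a::field fls alg_closure \<Rightarrow> 'c) \<Rightarrow> 'a fls \<Rightarrow> 'c" where
  "emb \<iota> z = \<iota> (to_ac z)"

text \<open>
  Functions on \<open>O\<close> are represented by functions on \<^typ>\<open>'a fls\<close> whose values outside
  \<^const>\<open>fls_integers\<close> are irrelevant.
\<close>

definition Fq_linear ::
    "('a::{field,finite} fls alg_closure \<Rightarrow> 'c::field) \<Rightarrow> ('a fls \<Rightarrow> 'c) \<Rightarrow> bool" where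
  "Fq_linear \<iota> u \<longleftrightarrow>
     (\<forall>s\<in>fls_integers. \<forall>t\<in>fls_integers. u (s + t) = u s + u t) \<and>
     (\<forall>\<alpha>. \<forall>t\<in>fls_integers. u (fls_const \<alpha> * t) = emb \<iota> (fls_const \<alpha>) * u t)"

definition C0 ::
    "('a::{field,finite} fls alg_closure \<Rightarrow> 'c::{field,topological_space}) \<Rightarrow> ('a fls \<Rightarrow> 'c) set" where
  "C0 \<iota> = {u. continuous_on fls_integers u \<and> Fq_linear \<iota> u}"

definition carlitz_bracket :: "nat \<Rightarrow> 'a::{field,finite} fls" where
  "carlitz_bracket i = fls_X ^ (CARD('a) ^ i) - fls_X"

definition carlitz_D :: "nat \<Rightarrow> 'a::{field,finite} fls" where
  "carlitz_D i = (\<Prod>j = 1..i. carlitz_bracket j ^ (CARD('a) ^ (i - j)))"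

definition carlitz_e :: "nat \<Rightarrow> 'a::{field,finite} fls \<Rightarrow> 'a fls" where
  "carlitz_e i t =
     (if i = 0 then t
      else (\<Prod>m \<in> {m :: 'a poly. Polynomial.degree m < i}. t - fps_to_fls (fps_of_poly m)))"

definition carlitz_f :: "nat \<Rightarrow> 'a::{field,finite} fls \<Rightarrow> 'a fls" where
  "carlitz_f i t = inverse (carlitz_D i) * carlitz_e i t"

definition carlitz_expansion ::
    "('a::{field,finite} fls alg_closure \<Rightarrow> 'c::{field,metric_space}) \<Rightarrow>
     ('a fls \<Rightarrow> 'c) \<Rightarrow> (nat \<Rightarrow> 'c) \<Rightarrow> bool" where
  "carlitz_expansion \<iota> u c \<longleftrightarrow>
     c \<longlonglongrightarrow> 0 \<and>
     uniform_limit fls_integers (\<lambda>N t. \<Sum>n<N. c n * emb \<iota> (carlitz_f n t)) u sequentially"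

primrec diff_op ::
    "('a::{field,finite} fls alg_closure \<Rightarrow> 'c::field) \<Rightarrow> nat \<Rightarrow> ('a fls \<Rightarrow> 'c) \<Rightarrow> 'a fls \<Rightarrow> 'c" where
  "diff_op \<iota> 0 u = u"
| "diff_op \<iota> (Suc n) u =
     (\<lambda>t. diff_op \<iota> n u (fls_X * t) - emb \<iota> fls_X ^ (CARD('a) ^ n) * diff_op \<iota> n u t)"

definition diff_quot ::
    "('a::{field,finite} fls alg_closure \<Rightarrow> 'c::field) \<Rightarrow> nat \<Rightarrow> ('a fls \<Rightarrow> 'c) \<Rightarrow> 'a fls \<Rightarrow> 'c" where
  "diff_quot \<iota> k u t = inverse (emb \<iota> t ^ (CARD('a) ^ k)) * diff_op \<iota> k u t"

text \<open>
  There is at most one extension on \<^const>\<open>fls_integers\<close>, because \<open>0\<close> is a limit point of it.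
\<close>

definition extends_diff_quot ::
    "('a::{field,finite} fls alg_closure \<Rightarrow> 'c::{field,topological_space}) \<Rightarrow> nat \<Rightarrow>
     ('a fls \<Rightarrow> 'c) \<Rightarrow> ('a fls \<Rightarrow> 'c) \<Rightarrow> bool" where
  "extends_diff_quot \<iota> k u g \<longleftrightarrow>
     continuous_on fls_integers g \<and> (\<forall>t\<in>fls_integers - {0}. g t = diff_quot \<iota> k u t)"

text \<open>\<open>C0_Suc \<iota> k\<close> is the space \<open>C_0\<close> with upper index \<open>k + 1\<close>.\<close>

definition C0_Suc ::
    "('a::{field,finite} fls alg_closure \<Rightarrow> 'c::{field,topological_space}) \<Rightarrow> nat \<Rightarrow>
     ('a fls \<Rightarrow> 'c) set" where
  "C0_Suc \<iota> k = {u \<in> C0 \<iota>. \<exists>g. extends_diff_quot \<iota> k u g}"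

end

theory Submission
  imports Defs
begin

text \<open>
  The normalized Carlitz polynomials satisfy \<open>f_n(x t) = x f_n(t) + f_{n-1}(t)^q\<close>. Hence
  \<open>\<Delta>^(k) u = \<Sum> c_{n+k} f_n^(q^k)\<close>, and evaluating at \<open>t = 1\<close> gives \<open>c_n = (\<Delta>^(n) u)(1)\<close>.
  The same recursion yields \<open>|f_n(t)| \<le> 1\<close> and \<open>|f_n(t)| \<le> q^n |t|\<close> on \<open>O\<close>. The second bound makes
  the series \<open>\<Sum> c_{n+k} (f_n(t) / t)^(q^k)\<close> converge uniformly if the weighted coefficients
  tend to \<open>0\<close>, and bounds its sum by their supremum.

  Conversely, put \<open>A i m = q^((i + m) q^k) |(\<Delta>^(k+i) u)(x^m)|\<close>. Row \<open>0\<close> consists of the values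
  \<open>|g(x^m)|\<close> of the extended difference quotient \<open>g\<close>, row \<open>1\<close> of the numbers
  \<open>|g(x^(m+1)) - g(x^m)|\<close>, which tend to \<open>0\<close> by continuity of \<open>g\<close> at \<open>0\<close>, and column \<open>0\<close> of the
  weighted coefficients \<open>q^(i q^k) |c_{k+i}|\<close>. The recursion defining the \<open>\<Delta>^(n)\<close> gives
  \<open>A (i+1) m \<le> max (A i (m+1)) (A i m)\<close>, with \<open>A i m / q\<close> in place of \<open>A i m\<close> if \<open>i > 0\<close>. This
  carries bounds and decay from the first two rows to column \<open>0\<close>.
\<close>

section \<open>The map y -> y^q on F_q and on K\<close>

text \<open>Multiplication by a nonzero \<open>x\<close> permutes the nonzero elements, so their
  product cancels. The extra factor \<open>x\<close> raises the exponent from q - 1 to q.\<close>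

lemma finite_field_pow_card:
  fixes x :: "'a::{field,finite}"
  shows "x ^ CARD('a) = x"
proof (cases "x = 0")
  case False
  have "x * (\<Prod>y\<in>UNIV-{0}. x * y) = x * x ^ (CARD('a) - 1) * \<Prod>(UNIV-{0})"
    by (simp add: prod.distrib mult_ac)
  also have "x * x ^ (CARD('a) - 1) = x ^ CARD('a)"
    by (subst power_Suc [symmetric]) simp
  also have "(\<Prod>y\<in>UNIV-{0}. x * y) = (\<Prod>y\<in>UNIV-{0}. y)"
    by (rule prod.reindex_bij_witness[of _ "\<lambda>y. y / x" "\<lambda>y. x * y"]) (use False in auto)
  finally show ?thesis
    by simp
qed simp

text \<open>
  \<open>(X + 1)^q\<close> and \<open>X^q + 1\<close> have the same leading coefficient and agree at all \<open>q\<close> points of the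
  field. This replaces the fact that \<open>q\<close> is a power of the characteristic.
\<close>

lemma of_nat_card_choose_eq_0:
  assumes "0 < k" "k < CARD('a::{field,finite})"
  shows "of_nat (CARD('a) choose k) = (0 :: 'a)"
proof -
  have "[:1, 1 :: 'a:] ^ CARD('a) = Polynomial.monom 1 CARD('a) + 1"
  proof (rule poly_eqI_degree_lead_coeff[where A = UNIV and n = "CARD('a)"])
    show "Polynomial.degree (Polynomial.monom 1 CARD('a) + 1 :: 'a poly) \<le> CARD('a)"
      by (rule degree_add_le) (auto simp: degree_monom_le)
    show "Polynomial.coeff ([:1, 1 :: 'a:] ^ CARD('a)) CARD('a) =
        Polynomial.coeff (Polynomial.monom 1 CARD('a) + 1) CARD('a)"
      using coeff_linear_power[of 1 "CARD('a)"] by (simp add: coeff_eq_0)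
    show "poly ([:1, 1 :: 'a:] ^ CARD('a)) z = poly (Polynomial.monom 1 CARD('a) + 1) z" for z :: 'a
      by (simp add: poly_monom finite_field_pow_card)
  qed (auto simp: degree_linear_power)
  then have "Polynomial.coeff ([:1, 1 :: 'a:] ^ CARD('a)) k =
      Polynomial.coeff (Polynomial.monom 1 CARD('a) + 1) k"
    by simp
  then show ?thesis
    using assms by (simp add: coeff_linear_poly_power coeff_eq_0)
qed

text \<open>With the vanishing of the inner binomial coefficients as a hypothesis, the same lemma
  serves \<open>'a fls\<close> here and the completion \<open>'c\<close> later.\<close>

lemma frobenius_add:
  fixes a b :: "'b::comm_ring_1"
  assumes "n > 0" "\<And>k. 0 < k \<Longrightarrow> k < n \<Longrightarrow> of_nat (n choose k) = (0 :: 'b)"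
  shows "(a + b) ^ n = a ^ n + b ^ n"
proof -
  have "(a + b) ^ n = (\<Sum>k\<le>n. of_nat (n choose k) * a ^ k * b ^ (n - k))"
    by (rule binomial_ring)
  also have "\<dots> = (\<Sum>k\<in>{0,n}. of_nat (n choose k) * a ^ k * b ^ (n - k))"
    using assms(2) by (intro sum.mono_neutral_right) auto
  also have "\<dots> = a ^ n + b ^ n"
    using assms(1) by (simp add: add.commute)
  finally show ?thesis .
qed

lemma fls_frobenius_add:
  fixes a b :: "'a::{field,finite} fls"
  shows "(a + b) ^ CARD('a) = a ^ CARD('a) + b ^ CARD('a)"
  by (rule frobenius_add) (auto simp: fls_of_nat of_nat_card_choose_eq_0)

lemma fls_frobenius_diff:
  fixes a b :: "'a::{field,finite} fls"
  shows "(a - b) ^ CARD('a) = a ^ CARD('a) - b ^ CARD('a)"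
  using fls_frobenius_add[of "a - b" b] by (simp add: algebra_simps)

lemma fls_const_pow_card:
  "fls_const \<alpha> ^ CARD('a) = fls_const (\<alpha> :: 'a::{field,finite})"
  by (simp add: finite_field_pow_card flip: fls_const_power)

text \<open>For nonzero \<open>z\<close> both sides are monic of degree q in \<open>y\<close> and
  vanish at the q distinct points \<open>fls_const \<alpha> * z\<close>. For \<open>z = 0\<close>
  these points coincide, hence the separate case.\<close>

lemma prod_diff_const_mult:
  fixes y z :: "'a::{field,finite} fls"
  shows "(\<Prod>\<alpha>\<in>UNIV. y - fls_const \<alpha> * z) = y ^ CARD('a) - z ^ (CARD('a) - 1) * y"
proof (cases "z = 0")
  case True
  then show ?thesis
    using one_less_card_field[where 'a = 'a] by (simp add: power_0_left)
next
  case False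
  let ?P = "\<Prod>\<alpha>\<in>(UNIV :: 'a set). [:- (fls_const \<alpha> * z), 1:]"
  let ?Q = "Polynomial.monom 1 CARD('a) - [:0, z ^ (CARD('a) - 1):]"
  let ?A = "range (\<lambda>\<alpha>. fls_const \<alpha> * z)"
  have deg: "Polynomial.degree ?P = CARD('a)"
    by (subst degree_prod_eq_sum_degree) auto
  have "?P = ?Q"
  proof (rule poly_eqI_degree_lead_coeff[where A = ?A and n = "CARD('a)"])
    have "inj (\<lambda>\<alpha> :: 'a. fls_const \<alpha> * z)"
      using False by (auto simp: inj_on_def) (metis fls_const_nth)
    then show "CARD('a) \<le> card ?A"
      by (simp add: card_image)
    show "Polynomial.degree ?Q \<le> CARD('a)"
      using one_less_card_field[where 'a = 'a]
      by (intro degree_diff_le) (auto simp: degree_monom_le)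
    have "Polynomial.coeff ?P CARD('a) = Polynomial.lead_coeff ?P"
      using deg by simp
    also have "\<dots> = 1"
      by (subst lead_coeff_prod) auto
    also have "\<dots> = Polynomial.coeff ?Q CARD('a)"
      using one_less_card_field[where 'a = 'a] by (simp add: coeff_eq_0)
    finally show "Polynomial.coeff ?P CARD('a) = Polynomial.coeff ?Q CARD('a)" .
    show "poly ?P w = poly ?Q w" if "w \<in> ?A" for w
    proof -
      from that obtain \<alpha> where w: "w = fls_const \<alpha> * z" by blast
      have "poly ?P w = 0"
        by (auto simp: poly_prod w)
      moreover have "z ^ CARD('a) = z ^ (CARD('a) - 1) * z"
        by (metis power_minus_mult zero_less_card_finite)
      then have "poly ?Q w = 0"
        by (simp add: w poly_monom power_mult_distrib fls_const_pow_card)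
      ultimately show ?thesis by simp
    qed
  qed (use deg in auto)
  then have "poly ?P y = poly ?Q y" by simp
  then show ?thesis
    by (simp add: poly_prod poly_monom mult.commute)
qed

section \<open>The polynomials e_i: linearity and recursion\<close>

text \<open>Stated with coefficients instead of the degree so that \<open>i = 0\<close> gives
  \<open>{0}\<close>; then e_0(t) = t is covered by the product formula as well.\<close>

definition carlitz_nodes :: "nat \<Rightarrow> 'a::field poly set" where
  "carlitz_nodes i = {m. \<forall>j\<ge>i. Polynomial.coeff m j = 0}"

abbreviation poly_fls :: "'a::field poly \<Rightarrow> 'a fls" where
  "poly_fls m \<equiv> fps_to_fls (fps_of_poly m)"

lemma carlitz_nodes_0: "carlitz_nodes 0 = {0}"
  by (auto simp: carlitz_nodes_def poly_eq_iff)

lemma carlitz_nodes_pos: "i \<noteq> 0 \<Longrightarrow> carlitz_nodes i = {m. Polynomial.degree m < i}"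
  by (auto simp: carlitz_nodes_def coeff_eq_0 intro: le_degree)
     (metis degree_0 gr0I leading_coeff_0_iff linorder_not_le)

lemma carlitz_nodes_0_mem [simp]: "0 \<in> carlitz_nodes i"
  by (simp add: carlitz_nodes_def)

lemma bij_betw_carlitz_nodes_Suc:
  "bij_betw (\<lambda>(m, \<alpha>). m + Polynomial.monom \<alpha> i) (carlitz_nodes i \<times> UNIV) (carlitz_nodes (Suc i))"
  by (rule bij_betw_byWitness
        [where f' = "\<lambda>n. (n - Polynomial.monom (Polynomial.coeff n i) i, Polynomial.coeff n i)"])
     (auto simp: carlitz_nodes_def)

lemma finite_carlitz_nodes [simp]: "finite (carlitz_nodes i :: 'a::{field,finite} poly set)"
proof (induction i)
  case (Suc i)
  then show ?case
    using bij_betw_finite[OF bij_betw_carlitz_nodes_Suc[of i, where 'a = 'a]]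
    by (metis finite finite_cartesian_product)
qed (simp add: carlitz_nodes_0)

lemma carlitz_e_altdef:
  fixes t :: "'a::{field,finite} fls"
  shows "carlitz_e i t = (\<Prod>m\<in>carlitz_nodes i. t - poly_fls m)"
  by (simp add: carlitz_e_def carlitz_nodes_0 carlitz_nodes_pos)

lemma poly_fls_monom: "poly_fls (Polynomial.monom \<alpha> i) = fls_const \<alpha> * fls_X ^ i"
  by (simp add: fps_of_poly_monom fls_times_fps_to_fls fps_to_fls_power)

lemma carlitz_e_eq_0: "m \<in> carlitz_nodes i \<Longrightarrow> carlitz_e i (poly_fls m) = 0"
  unfolding carlitz_e_altdef by (rule prod_zero) auto

lemma carlitz_e_Suc_X_power: "carlitz_e (Suc i) (fls_X ^ i) = 0"
  using carlitz_e_eq_0[of "Polynomial.monom 1 i" "Suc i"]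
  by (simp add: poly_fls_monom carlitz_nodes_def)

text \<open>The nodes for \<open>Suc i\<close> are grouped by their coefficient at x^i.\<close>

lemma carlitz_e_Suc_prod:
  fixes t :: "'a::{field,finite} fls"
  shows "carlitz_e (Suc i) t = (\<Prod>\<alpha>\<in>UNIV. carlitz_e i (t - fls_const \<alpha> * fls_X ^ i))"
proof -
  have "carlitz_e (Suc i) t =
      (\<Prod>(m, \<alpha>)\<in>carlitz_nodes i \<times> UNIV. t - poly_fls (m + Polynomial.monom \<alpha> i))"
    unfolding carlitz_e_altdef
    by (subst prod.reindex_bij_betw [OF bij_betw_carlitz_nodes_Suc, symmetric])
       (simp add: case_prod_unfold)
  also have "\<dots> = (\<Prod>\<alpha>\<in>UNIV. \<Prod>m\<in>carlitz_nodes i. t - poly_fls (m + Polynomial.monom \<alpha> i))"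
    by (subst prod.cartesian_product [symmetric]) (rule prod.swap)
  also have "\<dots> = (\<Prod>\<alpha>\<in>UNIV. carlitz_e i (t - fls_const \<alpha> * fls_X ^ i))"
    by (simp add: carlitz_e_altdef fps_of_poly_add fps_to_fls_plus poly_fls_monom algebra_simps)
  finally show ?thesis .
qed

text \<open>The claims feed each other. Linearity of e_i turns the factors of
  \<open>carlitz_e_Suc_prod\<close> into e_i(t) - \<alpha> e_i(x^i), and
  \<open>prod_diff_const_mult\<close> yields the recursion. The recursion in turn makes e_(i+1)
  linear, since taking q-th powers is F_q-linear.\<close>

lemma carlitz_e_linear_Suc:
  fixes t :: "'a::{field,finite} fls"
  shows carlitz_e_add: "carlitz_e i (s + t) = carlitz_e i s + carlitz_e i t"
    and carlitz_e_const_mult: "carlitz_e i (fls_const \<alpha> * t) = fls_const \<alpha> * carlitz_e i t"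
    and carlitz_e_Suc: "carlitz_e (Suc i) t =
        carlitz_e i t ^ CARD('a) - carlitz_e i (fls_X ^ i) ^ (CARD('a) - 1) * carlitz_e i t"
proof -
  have lin_imp_Suc: "carlitz_e (Suc i) t =
      carlitz_e i t ^ CARD('a) - carlitz_e i (fls_X ^ i) ^ (CARD('a) - 1) * carlitz_e i t"
    if add: "\<And>s t :: 'a fls. carlitz_e i (s + t) = carlitz_e i s + carlitz_e i t"
      and mult: "\<And>\<alpha> t. carlitz_e i (fls_const \<alpha> * t) = fls_const \<alpha> * carlitz_e i (t :: 'a fls)"
    for i and t :: "'a fls"
  proof -
    have "carlitz_e i (t - s) = carlitz_e i t - carlitz_e i s" for s
      using add[of "t - s" s] by simp
    then show ?thesis
      by (simp add: carlitz_e_Suc_prod mult prod_diff_const_mult)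
  qed
  have lin: "(\<forall>s t :: 'a fls. carlitz_e i (s + t) = carlitz_e i s + carlitz_e i t) \<and>
    (\<forall>\<alpha> t. carlitz_e i (fls_const \<alpha> * t) = fls_const \<alpha> * carlitz_e i (t :: 'a fls))" for i
  proof (induction i)
    case 0
    then show ?case by (simp add: carlitz_e_def)
  next
    case (Suc i)
    then show ?case
      by (simp add: lin_imp_Suc fls_frobenius_add power_mult_distrib fls_const_pow_card)
         (simp add: algebra_simps)
  qed
  show "carlitz_e i (s + t) = carlitz_e i s + carlitz_e i t"
    "carlitz_e i (fls_const \<alpha> * t) = fls_const \<alpha> * carlitz_e i t"
    "carlitz_e (Suc i) t =
        carlitz_e i t ^ CARD('a) - carlitz_e i (fls_X ^ i) ^ (CARD('a) - 1) * carlitz_e i t"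
    using lin lin_imp_Suc by blast+
qed

section \<open>The factors D_i, the difference equation and the normalized f_i\<close>

lemma carlitz_D_0 [simp]: "carlitz_D 0 = 1"
  by (simp add: carlitz_D_def)

lemma carlitz_D_Suc:
  "carlitz_D (Suc i) = (carlitz_bracket (Suc i) * carlitz_D i ^ CARD('a) :: 'a::{field,finite} fls)"
proof -
  have "(\<Prod>j = 1..i. carlitz_bracket j ^ (CARD('a) ^ (Suc i - j))) =
      (\<Prod>j = 1..i. carlitz_bracket j ^ (CARD('a) ^ (i - j)) :: 'a fls) ^ CARD('a)"
    unfolding prod_power_distrib[of _ _ "CARD('a)"]
    by (intro prod.cong) (auto simp: Suc_diff_le mult.commute simp flip: power_mult)
  then show ?thesis
    by (simp add: carlitz_D_def)
qed

lemma carlitz_bracket_Suc: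
  "carlitz_bracket (Suc i) =
    (carlitz_bracket i ^ CARD('a) + carlitz_bracket 1 :: 'a::{field,finite} fls)"
  by (simp add: carlitz_bracket_def fls_frobenius_diff mult.commute flip: power_mult)

lemma carlitz_bracket_nonzero:
  assumes "i > 0"
  shows "carlitz_bracket i \<noteq> (0 :: 'a::{field,finite} fls)"
proof
  assume "carlitz_bracket i = (0 :: 'a fls)"
  then have "fls_subdegree (fls_X ^ (CARD('a) ^ i) :: 'a fls) = fls_subdegree (fls_X :: 'a fls)"
    by (simp add: carlitz_bracket_def)
  then have "int (CARD('a) ^ i) = 1" by simp
  then have "CARD('a) ^ i = 1" by linarith
  then show False
    using assms one_less_card_field[where 'a = 'a] by simp
qed

lemma carlitz_D_nonzero: "carlitz_D i \<noteq> (0 :: 'a::{field,finite} fls)"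
  by (auto simp: carlitz_D_def carlitz_bracket_nonzero)

text \<open>A simultaneous induction: the difference equation for e_(i+1) at t = x^i, where e_(i+1)
  vanishes, gives e_(i+1)(x^(i+1)) = [i+1] D_i^q = D_(i+1). This value is the constant in the
  recursion for e_(i+2), from which the next difference equation is computed.\<close>

lemma carlitz_e_difference:
  fixes t :: "'a::{field,finite} fls"
  shows carlitz_e_X_power: "carlitz_e i (fls_X ^ i) = (carlitz_D i :: 'a fls)"
    and carlitz_e_Suc_X_mult: "carlitz_e (Suc i) (fls_X * t) =
      fls_X * carlitz_e (Suc i) t + carlitz_bracket (Suc i) * carlitz_e i t ^ CARD('a)"
proof -
  have "carlitz_e i (fls_X ^ i) = (carlitz_D i :: 'a fls) \<and>
    (\<forall>t :: 'a fls. carlitz_e (Suc i) (fls_X * t) =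
      fls_X * carlitz_e (Suc i) t + carlitz_bracket (Suc i) * carlitz_e i t ^ CARD('a))"
  proof (induction i)
    case 0
    then show ?case
      by (simp add: carlitz_e_Suc carlitz_bracket_def power_mult_distrib)
        (simp add: carlitz_e_def algebra_simps)
  next
    case (Suc i)
    let ?q = "CARD('a)"
    have q: "a ^ ?q = a ^ (?q - 1) * a" for a :: "'a fls"
      by (metis power_minus_mult zero_less_card_finite)
    have D: "carlitz_e (Suc i) (fls_X ^ Suc i) = (carlitz_D (Suc i) :: 'a fls)"
      using Suc by (simp add: carlitz_e_Suc_X_power carlitz_D_Suc)
    have "carlitz_e (Suc (Suc i)) (fls_X * t) = fls_X * carlitz_e (Suc (Suc i)) t +
        carlitz_bracket (Suc (Suc i)) * carlitz_e (Suc i) t ^ ?q" for t :: "'a fls"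
    proof -
      define E where "E = carlitz_e (Suc i) t"
      define F where "F = carlitz_e i t ^ ?q"
      define B where "B = (carlitz_bracket (Suc i) :: 'a fls)"
      define d where "d = (carlitz_D (Suc i) :: 'a fls) ^ (?q - 1)"
      define d' where "d' = (carlitz_D i :: 'a fls) ^ (?q - 1)"
      have E: "E ^ ?q = F ^ ?q - d' ^ ?q * F"
        using Suc carlitz_e_Suc[of i t]
        by (simp add: E_def F_def d'_def fls_frobenius_diff power_mult_distrib)
      \<comment> \<open>As D_(i+1) = B D_i^q, the power B^(q-1) inside \<open>d\<close> is completed
        to B^q. By the formula \<open>E\<close>, the terms B^q F^q - d B F then collapse to B^q
        E^q.\<close>
      have dB: "d * B = B ^ ?q * d' ^ ?q"
        by (simp add: d_def d'_def B_def carlitz_D_Suc power_mult_distrib q[of B, unfolded B_def]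
            flip: power_mult) (simp add: mult_ac)
      have X: "fls_X ^ ?q - fls_X = (carlitz_bracket 1 :: 'a fls)"
        by (simp add: carlitz_bracket_def)
      have "carlitz_e (Suc (Suc i)) (fls_X * t) = (fls_X * E + B * F) ^ ?q - d * (fls_X * E + B * F)"
        using Suc D carlitz_e_Suc[of "Suc i" "fls_X * t"] by (simp add: E_def F_def B_def d_def)
      also have "\<dots> = fls_X ^ ?q * E ^ ?q + B ^ ?q * F ^ ?q - d * fls_X * E - (d * B) * F"
        by (simp add: fls_frobenius_add power_mult_distrib algebra_simps)
      also have "\<dots> = fls_X ^ ?q * E ^ ?q + B ^ ?q * E ^ ?q - d * fls_X * E"
        unfolding E dB by (simp add: algebra_simps)
      also have "\<dots> = fls_X * (E ^ ?q - d * E) + (B ^ ?q + (fls_X ^ ?q - fls_X)) * E ^ ?q"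
        by (simp add: algebra_simps)
      also have "E ^ ?q - d * E = carlitz_e (Suc (Suc i)) t"
        using D carlitz_e_Suc[of "Suc i" t] by (simp add: E_def d_def)
      also have "B ^ ?q + (fls_X ^ ?q - fls_X) = carlitz_bracket (Suc (Suc i))"
        unfolding X B_def by (rule carlitz_bracket_Suc [symmetric])
      finally show ?thesis by (simp add: E_def)
    qed
    with D show ?case by blast
  qed
  then show "carlitz_e i (fls_X ^ i) = (carlitz_D i :: 'a fls)"
    "carlitz_e (Suc i) (fls_X * t) =
      fls_X * carlitz_e (Suc i) t + carlitz_bracket (Suc i) * carlitz_e i t ^ CARD('a)"
    by blast+
qed

lemma carlitz_f_0 [simp]: "carlitz_f 0 t = t"
  by (simp add: carlitz_f_def carlitz_e_def)

lemma carlitz_f_add: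
  fixes t :: "'a::{field,finite} fls"
  shows "carlitz_f i (s + t) = carlitz_f i s + carlitz_f i t"
  by (simp add: carlitz_f_def carlitz_e_add distrib_left)

text \<open>Division by D_(i+1) = [i+1] D_i^q removes the bracket from the difference
  equation.\<close>

lemma carlitz_f_Suc_X_mult:
  fixes t :: "'a::{field,finite} fls"
  shows "carlitz_f (Suc i) (fls_X * t) = fls_X * carlitz_f (Suc i) t + carlitz_f i t ^ CARD('a)"
  using carlitz_bracket_nonzero[of "Suc i", where 'a = 'a] carlitz_D_nonzero[of i, where 'a = 'a]
  by (simp add: carlitz_f_def carlitz_e_Suc_X_mult carlitz_D_Suc power_mult_distrib field_simps)

lemma carlitz_f_Suc_const [simp]:
  "carlitz_f (Suc i) (fls_const \<alpha>) = (0 :: 'a::{field,finite} fls)"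
  using carlitz_e_eq_0[of "Polynomial.monom \<alpha> 0" "Suc i"]
  by (simp add: carlitz_f_def poly_fls_monom carlitz_nodes_def)

section \<open>The absolute value and the integers of K\<close>

lemma fls_abs_0 [simp]: "fls_abs 0 = 0"
  by (simp add: fls_abs_def)

lemma fls_abs_nonneg [simp]: "0 \<le> fls_abs z"
  by (simp add: fls_abs_def)

lemma fls_abs_eq_0_iff [simp]: "fls_abs z = 0 \<longleftrightarrow> z = 0"
  by (simp add: fls_abs_def)

lemma fls_abs_pos: "z \<noteq> 0 \<Longrightarrow> 0 < fls_abs z"
  using fls_abs_nonneg[of z] fls_abs_eq_0_iff[of z] by linarith

lemma fls_abs_1 [simp]: "fls_abs 1 = 1"
  by (simp add: fls_abs_def)

lemma fls_abs_mult: "fls_abs (a * b) = fls_abs a * fls_abs b"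
  by (auto simp: fls_abs_def power_int_add[symmetric])

lemma fls_abs_power: "fls_abs (a ^ n) = fls_abs a ^ n"
  by (induction n) (auto simp: fls_abs_mult)

lemma fls_abs_prod: "fls_abs (prod f A) = (\<Prod>i\<in>A. fls_abs (f i))"
  by (induction A rule: infinite_finite_induct) (auto simp: fls_abs_mult)

lemma fls_abs_minus [simp]: "fls_abs (- a) = fls_abs a"
  by (simp add: fls_abs_def)

lemma fls_abs_le_iff_subdegree:
  fixes a :: "'a::{field,finite} fls"
  assumes "a \<noteq> 0"
  shows "fls_abs a \<le> real CARD('a) powi (- n) \<longleftrightarrow> n \<le> fls_subdegree a"
  using assms one_less_card_field[where 'a = 'a]
    power_int_strict_increasing[of "- n" "- fls_subdegree a" "real CARD('a)"]
    power_int_increasing[of "- fls_subdegree a" "- n" "real CARD('a)"]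
  by (fastforce simp: fls_abs_def)

lemma fls_abs_add_le: "fls_abs (a + b) \<le> max (fls_abs a) (fls_abs b)"
proof (cases "a = 0 \<or> b = 0 \<or> a + b = 0")
  case False
  let ?q = "real CARD('a)"
  have "min (fls_subdegree a) (fls_subdegree b) \<le> fls_subdegree (a + b)"
    using False by (intro fls_plus_subdegree) auto
  then have "fls_abs (a + b) \<le> ?q powi (- min (fls_subdegree a) (fls_subdegree b))"
    using False by (simp add: fls_abs_le_iff_subdegree)
  also have "\<dots> \<le> max (fls_abs a) (fls_abs b)"
    using False by (auto simp: fls_abs_def min_def)
  finally show ?thesis .
qed (auto simp: max_def)

lemma fls_abs_diff_le: "fls_abs (a - b) \<le> max (fls_abs a) (fls_abs b)"
  using fls_abs_add_le[of a "- b"] by simp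

lemma fls_abs_X: "fls_abs (fls_X :: 'a::{field,finite} fls) = 1 / real CARD('a)"
  by (simp add: fls_abs_def power_int_minus field_simps)

lemma mem_fls_integers_iff:
  "z \<in> (fls_integers :: 'a::{field,finite} fls set) \<longleftrightarrow> 0 \<le> fls_subdegree z"
  using fls_abs_le_iff_subdegree[of z 0] by (cases "z = 0") (auto simp: fls_integers_def)

lemma fls_integers_0 [simp]: "0 \<in> fls_integers"
  and fls_integers_1 [simp]: "1 \<in> fls_integers"
  and fls_integers_X [simp]: "fls_X \<in> fls_integers"
  by (simp_all add: mem_fls_integers_iff)

lemma fls_integers_mult: "a \<in> fls_integers \<Longrightarrow> b \<in> fls_integers \<Longrightarrow> a * b \<in> fls_integers"
  by (simp add: fls_integers_def fls_abs_mult mult_le_one)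

lemma fls_integers_diff: "a \<in> fls_integers \<Longrightarrow> b \<in> fls_integers \<Longrightarrow> a - b \<in> fls_integers"
  using fls_abs_diff_le[of a b] by (simp add: fls_integers_def)

lemma fls_integers_power: "a \<in> fls_integers \<Longrightarrow> a ^ n \<in> fls_integers"
  by (simp add: fls_integers_def fls_abs_power power_le_one)

lemma fls_integers_prod: "(\<And>i. i \<in> A \<Longrightarrow> f i \<in> fls_integers) \<Longrightarrow> prod f A \<in> fls_integers"
  by (simp add: fls_integers_def fls_abs_prod prod_le_1)

lemma fls_integers_fps [simp]: "fps_to_fls m \<in> fls_integers"
  by (simp add: mem_fls_integers_iff fls_subdegree_fls_to_fps_gt0)

text \<open>For inductions over O: f_(n+1) kills the constant, so that the recursion for f_(n+1)(x
  s) applies to every integral argument.\<close>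

lemma fls_integersE_const_add_X_mult:
  fixes t :: "'a::{field,finite} fls"
  assumes "t \<in> fls_integers"
  obtains \<alpha> s where "s \<in> fls_integers" "t = fls_const \<alpha> + fls_X * s"
proof
  let ?s = "fls_shift 1 (t - fls_const (fls_nth t 0))"
  have t: "fls_nth t n = 0" if "n < 0" for n
    using assms that by (intro fls_eq0_below_subdegree) (simp add: mem_fls_integers_iff)
  then show "?s \<in> fls_integers"
    unfolding mem_fls_integers_iff by (intro fls_subdegree_ge0I) simp
  show "t = fls_const (fls_nth t 0) + fls_X * ?s"
    by (simp add: fls_X_times_conv_shift)
qed

section \<open>Bounds for f_n on O\<close>

lemma carlitz_f_Suc_const_add_X_mult:
  fixes s :: "'a::{field,finite} fls"
  shows "carlitz_f (Suc n) (fls_const \<alpha> + fls_X * s) =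
    fls_X * carlitz_f (Suc n) s + carlitz_f n s ^ CARD('a)"
  by (simp add: carlitz_f_add carlitz_f_Suc_X_mult)

lemma carlitz_f_zero [simp]: "carlitz_f n 0 = (0 :: 'a::{field,finite} fls)"
  using carlitz_f_add[of n 0 "0 :: 'a fls"] by (metis add.right_neutral add_left_cancel)

lemma carlitz_e_integer: "t \<in> fls_integers \<Longrightarrow> carlitz_e n t \<in> fls_integers"
  unfolding carlitz_e_altdef by (intro fls_integers_prod fls_integers_diff) auto

text \<open>Since e_(n+1) is integral on O, \<open>C\<close> is a first bound for f_(n+1). Each
  removal of a constant term divides this bound by q, while the summand f_n(s)^q stays at most 1.
  Letting \<open>N\<close> grow leaves the bound 1.\<close>

lemma carlitz_f_integer:
  fixes t :: "'a::{field,finite} fls"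
  assumes "t \<in> fls_integers"
  shows "carlitz_f n t \<in> fls_integers"
  using assms
proof (induction n arbitrary: t)
  case (Suc n)
  let ?q = "real CARD('a)"
  define C where "C = fls_abs (inverse (carlitz_D (Suc n) :: 'a fls))"
  have q: "1 < ?q"
    using one_less_card_field[where 'a = 'a] by simp
  have bound: "fls_abs (carlitz_f (Suc n) t) \<le> max 1 (C / ?q ^ N)"
    if "t \<in> fls_integers" for N and t :: "'a fls"
    using that
  proof (induction N arbitrary: t)
    case 0
    have "fls_abs (carlitz_f (Suc n) t) \<le> C"
      using carlitz_e_integer[OF 0, of "Suc n"]
      by (simp add: carlitz_f_def C_def fls_integers_def fls_abs_mult mult_left_le)
    then show ?case by simp
  next
    case (Suc N)
    obtain \<alpha> s where s: "s \<in> fls_integers" "t = fls_const \<alpha> + fls_X * s"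
      using Suc.prems by (rule fls_integersE_const_add_X_mult)
    have "fls_abs (fls_X * carlitz_f (Suc n) s) \<le> max 1 (C / ?q ^ Suc N)"
    proof -
      have "fls_abs (carlitz_f (Suc n) s) / ?q \<le> max 1 (C / ?q ^ N) / ?q"
        using Suc.IH[OF s(1)] q by (intro divide_right_mono) auto
      also have "\<dots> = max (1 / ?q) (C / ?q ^ Suc N)"
        using q by (simp add: max_divide_distrib_right mult.commute)
      also have "\<dots> \<le> max 1 (C / ?q ^ Suc N)"
        using q by (intro max.mono) auto
      finally show ?thesis by (simp add: fls_abs_mult fls_abs_X)
    qed
    moreover have "fls_abs (carlitz_f n s ^ CARD('a)) \<le> 1"
      using Suc.prems \<open>\<And>t. t \<in> fls_integers \<Longrightarrow> carlitz_f n t \<in> fls_integers\<close>[OF s(1)]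
      by (simp add: fls_integers_def fls_abs_power power_le_one)
    ultimately show ?case
      using fls_abs_add_le[of "fls_X * carlitz_f (Suc n) s" "carlitz_f n s ^ CARD('a)"]
      unfolding s(2) carlitz_f_Suc_const_add_X_mult by linarith
  qed
  have "(\<lambda>N. max 1 (C / ?q ^ N)) \<longlonglongrightarrow> max 1 0"
    using q by (intro tendsto_max tendsto_const LIMSEQ_divide_realpow_zero)
  then have "fls_abs (carlitz_f (Suc n) t) \<le> max 1 0"
    using bound[OF Suc.prems] by (intro LIMSEQ_le_const) auto
  then show ?case
    by (simp add: fls_integers_def)
qed simp

text \<open>The inner induction is on the order of \<open>t\<close>. If |t| = 1, integrality of
  f_(n+1)(t) suffices. If t = x s, the summand x f_(n+1)(s) loses the same factor q as |t|; and
  |f_n(s)^q| is at most |f_n(s)|, hence at most q^n |s| = q^(n+1) |t|.\<close>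

lemma fls_abs_carlitz_f_le:
  fixes t :: "'a::{field,finite} fls"
  assumes "t \<in> fls_integers"
  shows "fls_abs (carlitz_f n t) \<le> real CARD('a) ^ n * fls_abs t"
  using assms
proof (induction n arbitrary: t)
  case (Suc n)
  let ?q = "real CARD('a)"
  have q: "1 < ?q"
    using one_less_card_field[where 'a = 'a] by simp
  have "fls_abs (carlitz_f (Suc n) t) \<le> ?q ^ Suc n * fls_abs t"
    if "t \<in> fls_integers" "t = 0 \<or> fls_subdegree t \<le> int m" for m and t :: "'a fls"
    using that
  proof (induction m arbitrary: t)
    case 0
    show ?case
    proof (cases "t = 0")
      case False
      then have "fls_abs t = 1"
        using 0 by (simp add: fls_abs_def mem_fls_integers_iff)
      moreover have "fls_abs (carlitz_f (Suc n) t) \<le> 1"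
        using carlitz_f_integer[OF 0(1)] by (simp add: fls_integers_def)
      moreover have "1 \<le> ?q ^ Suc n"
        using q by (intro one_le_power) simp
      ultimately show ?thesis by simp
    qed simp
  next
    case (Suc m)
    obtain \<alpha> s where s: "s \<in> fls_integers" "t = fls_const \<alpha> + fls_X * s"
      using Suc.prems(1) by (rule fls_integersE_const_add_X_mult)
    show ?case
    proof (cases "\<alpha> = 0")
      case True
      have t: "t = fls_X * s"
        using s True by simp
      have abs_t: "fls_abs t = fls_abs s / ?q"
        by (simp add: t fls_abs_mult fls_abs_X)
      have "s = 0 \<or> fls_subdegree s \<le> int m"
        using Suc.prems by (cases "s = 0") (auto simp: t)
      then have "fls_abs (carlitz_f (Suc n) s) \<le> ?q ^ Suc n * fls_abs s"
        using Suc.IH s(1) by blast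
      then have "fls_abs (carlitz_f (Suc n) s) / ?q \<le> ?q ^ Suc n * fls_abs s / ?q"
        using q by (intro divide_right_mono) auto
      then have "fls_abs (fls_X * carlitz_f (Suc n) s) \<le> ?q ^ Suc n * fls_abs t"
        by (simp add: fls_abs_mult fls_abs_X abs_t)
      moreover have "fls_abs (carlitz_f n s ^ CARD('a)) \<le> ?q ^ Suc n * fls_abs t"
      proof -
        have "fls_abs (carlitz_f n s) ^ CARD('a) \<le> fls_abs (carlitz_f n s) ^ 1"
          using carlitz_f_integer[OF s(1), of n]
          by (intro power_decreasing) (auto simp: fls_integers_def Suc_leI)
        also have "\<dots> \<le> ?q ^ n * fls_abs s"
          using \<open>\<And>t. t \<in> fls_integers \<Longrightarrow> fls_abs (carlitz_f n t) \<le> ?q ^ n * fls_abs t\<close>[OF s(1)]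
          by simp
        also have "\<dots> = ?q ^ Suc n * fls_abs t"
          using q by (simp add: abs_t)
        finally show ?thesis by (simp add: fls_abs_power)
      qed
      ultimately show ?thesis
        using fls_abs_add_le[of "fls_X * carlitz_f (Suc n) s" "carlitz_f n s ^ CARD('a)"]
        unfolding t carlitz_f_Suc_X_mult by linarith
    next
      case False
      have "fls_nth t 0 = \<alpha>"
        using s(1) unfolding s(2)
        by (simp add: fls_X_times_conv_shift mem_fls_integers_iff)
      then have "fls_subdegree t \<le> int 0"
        using False by (simp add: fls_subdegree_leI)
      moreover have "fls_subdegree t \<ge> 0"
        using Suc.prems(1) by (simp add: mem_fls_integers_iff)
      moreover have "t \<noteq> 0"
        using \<open>fls_nth t 0 = \<alpha>\<close> False by auto
      ultimately have "fls_abs t = 1"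
        by (simp add: fls_abs_def)
      moreover have "fls_abs (carlitz_f (Suc n) t) \<le> 1"
        using carlitz_f_integer[OF Suc.prems(1)] by (simp add: fls_integers_def)
      moreover have "1 \<le> ?q ^ Suc n"
        using q by (intro one_le_power) simp
      ultimately show ?thesis by simp
    qed
  qed
  from this[of t "nat (fls_subdegree t)"] Suc.prems show ?case
    by (simp add: mem_fls_integers_iff)
qed simp

section \<open>Lipschitz estimates and the quotients f_n(t) / t\<close>

text \<open>The factors are exchanged one at a time. By the ultrametric inequality the errors do not
  add up.\<close>

lemma fls_abs_prod_diff_le:
  fixes f g :: "'b \<Rightarrow> 'a::{field,finite} fls"
  assumes "\<And>i. i \<in> A \<Longrightarrow> f i \<in> fls_integers" "\<And>i. i \<in> A \<Longrightarrow> g i \<in> fls_integers"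
    and "\<And>i. i \<in> A \<Longrightarrow> fls_abs (f i - g i) \<le> d" "0 \<le> d"
  shows "fls_abs (prod f A - prod g A) \<le> d"
  using assms
proof (induction A rule: infinite_finite_induct)
  case (insert x A)
  let ?P = "prod f A" and ?R = "prod g A"
  have P: "fls_abs ?P \<le> 1"
    using fls_integers_prod[of A f] insert.prems(1) by (simp add: fls_integers_def)
  have g: "fls_abs (g x) \<le> 1"
    using insert.prems(2) by (simp add: fls_integers_def)
  have eq: "prod f (insert x A) - prod g (insert x A) = (f x - g x) * ?P + g x * (?P - ?R)"
    using insert.hyps by (simp add: algebra_simps)
  have "fls_abs ((f x - g x) * ?P) \<le> d"
    using mult_mono[of "fls_abs (f x - g x)" d "fls_abs ?P" 1] P insert.prems
    by (simp add: fls_abs_mult)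
  moreover have "fls_abs (g x * (?P - ?R)) \<le> d"
    using mult_mono[of "fls_abs (g x)" 1 "fls_abs (?P - ?R)" d] g insert
    by (simp add: fls_abs_mult)
  ultimately show ?case
    unfolding eq using fls_abs_add_le[of "(f x - g x) * ?P" "g x * (?P - ?R)"] by linarith
qed simp_all

lemma fls_abs_power_diff_le:
  fixes a b :: "'a::{field,finite} fls"
  assumes "a \<in> fls_integers" "b \<in> fls_integers"
  shows "fls_abs (a ^ n - b ^ n) \<le> fls_abs (a - b)"
  using fls_abs_prod_diff_le[of "{..<n}" "\<lambda>_. a" "\<lambda>_. b" "fls_abs (a - b)"] assms by simp

text \<open>The root \<open>0\<close> of \<open>e_n\<close> is left out, so this is \<open>f_n(t) / t\<close>, extended to \<open>t = 0\<close>.\<close>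

definition carlitz_phi :: "nat \<Rightarrow> 'a::{field,finite} fls \<Rightarrow> 'a fls" where
  "carlitz_phi n t = inverse (carlitz_D n) * (\<Prod>m\<in>carlitz_nodes n - {0}. t - poly_fls m)"

lemma carlitz_f_eq_mult_phi: "carlitz_f n t = t * carlitz_phi n t"
  unfolding carlitz_f_def carlitz_phi_def carlitz_e_altdef
  by (subst prod.remove[of _ 0]) (auto simp: mult_ac)

text \<open>Apart from the inverse of D_n, all factors are integral and change by s - t.\<close>

lemma carlitz_phi_power_lipschitz:
  fixes s t :: "'a::{field,finite} fls"
  assumes "s \<in> fls_integers" "t \<in> fls_integers"
  shows "fls_abs (carlitz_phi n s ^ r - carlitz_phi n t ^ r) \<le>
    fls_abs (inverse (carlitz_D n :: 'a fls)) ^ r * fls_abs (s - t)"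
proof -
  let ?P = "\<lambda>t :: 'a fls. \<Prod>m\<in>carlitz_nodes n - {0}. t - poly_fls m"
  have int: "?P t \<in> fls_integers" if "t \<in> fls_integers" for t
    using that by (intro fls_integers_prod fls_integers_diff) auto
  have "fls_abs (?P s ^ r - ?P t ^ r) \<le> fls_abs (?P s - ?P t)"
    using assms by (intro fls_abs_power_diff_le int)
  also have "\<dots> \<le> fls_abs (s - t)"
    using assms by (intro fls_abs_prod_diff_le fls_integers_diff) auto
  finally have "fls_abs (?P s ^ r - ?P t ^ r) \<le> fls_abs (s - t)" .
  moreover have "carlitz_phi n s ^ r - carlitz_phi n t ^ r =
      inverse (carlitz_D n) ^ r * (?P s ^ r - ?P t ^ r)"
    by (simp add: carlitz_phi_def power_mult_distrib right_diff_distrib)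
  ultimately show ?thesis
    by (simp add: fls_abs_mult fls_abs_power mult_left_mono)
qed

lemma fls_abs_X_power_tendsto_0: "(\<lambda>m. fls_abs (fls_X ^ m :: 'a::{field,finite} fls)) \<longlonglongrightarrow> 0"
  using one_less_card_field[where 'a = 'a]
  by (auto simp: fls_abs_power fls_abs_X intro!: LIMSEQ_realpow_zero)

text \<open>For nonzero \<open>t\<close> the bound on f_n(t) is divided by |t|. The value at 0 is
  compared with those at x^m, with a Lipschitz error that tends to 0.\<close>

lemma fls_abs_carlitz_phi_le:
  fixes t :: "'a::{field,finite} fls"
  assumes "t \<in> fls_integers"
  shows "fls_abs (carlitz_phi n t) \<le> real CARD('a) ^ n"
proof -
  have nz: "fls_abs (carlitz_phi n t) \<le> real CARD('a) ^ n"
    if "t \<in> fls_integers" "t \<noteq> 0" for t :: "'a fls"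
    using fls_abs_carlitz_f_le[OF that(1), of n] that(2)
    by (simp add: carlitz_f_eq_mult_phi fls_abs_mult mult.commute[of "fls_abs t"] fls_abs_pos)
  show ?thesis
  proof (cases "t = 0")
    case True
    let ?C = "fls_abs (inverse (carlitz_D n :: 'a fls))"
    have "fls_abs (carlitz_phi n (0 :: 'a fls)) \<le> max (real CARD('a) ^ n) (?C * fls_abs (fls_X ^ m :: 'a fls))" for m
    proof -
      have "fls_abs (carlitz_phi n (0 :: 'a fls)) \<le> max (fls_abs (carlitz_phi n (fls_X ^ m :: 'a fls)))
          (fls_abs (carlitz_phi n (fls_X ^ m) - carlitz_phi n (0 :: 'a fls)))"
        using fls_abs_diff_le[of "carlitz_phi n (fls_X ^ m)"
            "carlitz_phi n (fls_X ^ m) - carlitz_phi n (0 :: 'a fls)"] by simp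
      also have "\<dots> \<le> max (real CARD('a) ^ n) (?C * fls_abs (fls_X ^ m :: 'a fls))"
        using carlitz_phi_power_lipschitz[of "fls_X ^ m" "0 :: 'a fls" n 1]
        by (intro max.mono nz) (auto simp: fls_integers_power)
      finally show ?thesis .
    qed
    moreover have "(\<lambda>m. max (real CARD('a) ^ n) (?C * fls_abs (fls_X ^ m :: 'a fls)))
        \<longlonglongrightarrow> max (real CARD('a) ^ n) (?C * 0)"
      by (intro tendsto_max tendsto_const tendsto_mult fls_abs_X_power_tendsto_0)
    ultimately have "fls_abs (carlitz_phi n (0 :: 'a fls)) \<le> max (real CARD('a) ^ n) (?C * 0)"
      by (intro LIMSEQ_le_const) auto
    then show ?thesis by (simp add: True)
  qed (use nz assms in blast)
qed

section \<open>Limits in K and decay in double arrays\<close>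

lemma tendsto_fls_iff_abs:
  fixes z :: "'a::{field,finite} fls"
  shows "(f \<longlongrightarrow> z) F \<longleftrightarrow> ((\<lambda>n. fls_abs (f n - z)) \<longlongrightarrow> 0) F"
proof
  assume lim: "(f \<longlongrightarrow> z) F"
  show "((\<lambda>n. fls_abs (f n - z)) \<longlongrightarrow> 0) F"
  proof (rule tendstoI)
    fix e :: real
    assume "0 < e"
    have "open {w. fls_abs (w - z) < e}"
      unfolding open_fls_iff_fls_abs
    proof (intro ballI exI[of _ e] conjI allI impI)
      fix a w assume "a \<in> {w. fls_abs (w - z) < e}" "fls_abs (w - a) < e"
      then show "w \<in> {w. fls_abs (w - z) < e}"
        using fls_abs_add_le[of "w - a" "a - z"] by (simp add: max_def split: if_splits)
    qed (use \<open>0 < e\<close> in simp)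
    then show "\<forall>\<^sub>F n in F. dist (fls_abs (f n - z)) 0 < e"
      using topological_tendstoD[OF lim, of "{w. fls_abs (w - z) < e}"] \<open>0 < e\<close> by simp
  qed
next
  assume lim: "((\<lambda>n. fls_abs (f n - z)) \<longlongrightarrow> 0) F"
  show "(f \<longlongrightarrow> z) F"
  proof (rule topological_tendstoI)
    fix S assume "open S" "z \<in> S"
    then obtain e where e: "0 < e" "\<And>w. fls_abs (w - z) < e \<Longrightarrow> w \<in> S"
      unfolding open_fls_iff_fls_abs by blast
    show "\<forall>\<^sub>F n in F. f n \<in> S"
      using order_tendstoD(2)[OF lim e(1)] by eventually_elim (use e in blast)
  qed
qed

text \<open>Unrolling \<open>step\<close> leads from \<open>B i 0\<close> back to row 0. Each path
  either moves far to the right, where row 0 is small, or collects many divisions by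
  \<open>r\<close>.\<close>

lemma double_sequence_decay:
  fixes B :: "nat \<Rightarrow> nat \<Rightarrow> real"
  assumes nonneg: "\<And>i m. 0 \<le> B i m" and "1 < r" and lim: "B 0 \<longlonglongrightarrow> 0"
    and step: "\<And>i m. B (Suc i) m \<le> max (B i (Suc m)) (B i m / r)"
  shows "(\<lambda>i. B i 0) \<longlonglongrightarrow> 0"
proof (rule LIMSEQ_I)
  fix e :: real
  assume "0 < e"
  then obtain N where N: "\<And>m. m \<ge> N \<Longrightarrow> B 0 m < e"
    using LIMSEQ_D[OF lim] nonneg by fastforce
  obtain C where C: "\<And>m. B 0 m \<le> C"
    using Bseq_eq_bounded convergent_imp_Bseq lim nonneg
    by (metis (no_types, opaque_lifting) BseqE abs_of_nonneg convergentI real_norm_def)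
  have "0 \<le> C" using C[of 0] nonneg[of 0 0] by linarith
  \<comment> \<open>Both alternatives of \<open>step\<close> fit the exponent m + i: one shifts
    \<open>m\<close>, the other divides by \<open>r\<close>. In row 0 the factor
    \<open>r ^ N\<close> covers the indices below \<open>N\<close>, where only the bound
    \<open>C\<close> is known; \<open>e / 2\<close> makes the inequality strict there.\<close>
  have bound: "B i m < max e (C * r ^ N / r ^ (m + i) + e / 2)" for i m
  proof (induction i arbitrary: m)
    case 0
    show ?case
    proof (cases "m \<ge> N")
      case True
      with N[of m] show ?thesis by simp
    next
      case False
      then have "r ^ m \<le> r ^ N"
        using \<open>1 < r\<close> by (intro power_increasing) auto
      then have "C * r ^ m \<le> C * r ^ N"
        using \<open>0 \<le> C\<close> by (rule mult_left_mono)
      then have "C \<le> C * r ^ N / r ^ m"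
        using \<open>1 < r\<close> by (simp add: field_simps)
      with C[of m] \<open>0 < e\<close> show ?thesis by simp
    qed
  next
    case (Suc i)
    have "B i m / r < max e (C * r ^ N / r ^ (m + i) + e / 2) / r"
      using Suc[of m] \<open>1 < r\<close> by (intro divide_strict_right_mono) auto
    also have "\<dots> = max (e / r) (C * r ^ N / r ^ (m + Suc i) + e / 2 / r)"
      using \<open>1 < r\<close> by (simp add: max_divide_distrib_right add_divide_distrib mult.commute)
    also have "\<dots> \<le> max e (C * r ^ N / r ^ (m + Suc i) + e / 2)"
      using \<open>1 < r\<close> \<open>0 < e\<close> by (intro max.mono add_left_mono) (auto simp: field_simps)
    finally have "B i m / r < max e (C * r ^ N / r ^ (m + Suc i) + e / 2)" .
    moreover have "B i (Suc m) < max e (C * r ^ N / r ^ (m + Suc i) + e / 2)"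
      using Suc[of "Suc m"] by simp
    ultimately show ?case
      using step[of i m] by linarith
  qed
  have "(\<lambda>i. C * r ^ N / r ^ i) \<longlonglongrightarrow> 0"
    using \<open>1 < r\<close> by (intro LIMSEQ_divide_realpow_zero)
  then obtain M where M: "\<And>i. i \<ge> M \<Longrightarrow> C * r ^ N / r ^ i < e / 2"
    using LIMSEQ_D[of _ 0 "e / 2"] \<open>0 < e\<close> by (metis abs_less_iff diff_zero half_gt_zero real_norm_def)
  have "norm (B i 0 - 0) < e" if "i \<ge> M" for i
    using bound[of i 0] M[OF that] nonneg[of i 0] by (simp add: max_def split: if_splits)
  then show "\<exists>no. \<forall>n\<ge>no. norm (B n 0 - 0) < e" by blast
qed

section \<open>The absolute value on the completion\<close>

context completed_alg_closure
begin

lemma hom_zero [simp]: "\<iota> 0 = 0"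
  using hom_add[of 0 0] by (metis add.right_neutral add_left_cancel)

lemma emb_0 [simp]: "emb \<iota> 0 = 0"
  by (simp add: emb_def)

lemma emb_1 [simp]: "emb \<iota> 1 = 1"
  by (simp add: emb_def hom_one)

lemma emb_add: "emb \<iota> (a + b) = emb \<iota> a + emb \<iota> b"
  by (simp add: emb_def hom_add)

lemma emb_diff: "emb \<iota> (a - b) = emb \<iota> a - emb \<iota> b"
  using emb_add[of "a - b" b] by simp

lemma emb_mult: "emb \<iota> (a * b) = emb \<iota> a * emb \<iota> b"
  by (simp add: emb_def hom_mult)

lemma emb_power: "emb \<iota> (a ^ n) = emb \<iota> a ^ n"
  by (induction n) (simp_all add: emb_mult)

lemma emb_of_nat: "emb \<iota> (of_nat n) = of_nat n"
  by (induction n) (simp_all add: emb_add)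

lemma abv_emb: "abv (emb \<iota> a) = fls_abs a"
  by (simp add: emb_def abv_extends)

lemma abv_0 [simp]: "abv 0 = 0"
  using dist_abv[of 0 0] by simp

lemma emb_eq_0_iff [simp]: "emb \<iota> a = 0 \<longleftrightarrow> a = 0"
proof
  assume "emb \<iota> a = 0"
  then show "a = 0"
    using abv_emb[of a] by simp
qed simp

lemma abv_eq_dist: "abv a = dist a 0"
  by (simp add: dist_abv)

lemma abv_nonneg [simp]: "0 \<le> abv a"
  by (simp add: abv_eq_dist)

lemma abv_1 [simp]: "abv 1 = 1"
  using abv_emb[of 1] by simp

lemma abv_power: "abv (a ^ n) = abv a ^ n"
  by (induction n) (simp_all add: abv_mult)

lemma abv_minus [simp]: "abv (- a) = abv a"
  using dist_abv[of 0 a] dist_abv[of a 0] by (simp add: dist_commute)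

lemma abv_triangle: "abv (a + b) \<le> abv a + abv b"
  using dist_triangle[of a "- b" 0] by (simp add: dist_abv)

lemma of_nat_card_choose_eq_0_completion:
  assumes "0 < k" "k < CARD('a)"
  shows "of_nat (CARD('a) choose k) = (0 :: 'c)"
proof -
  have "of_nat (CARD('a) choose k) = (0 :: 'a fls)"
    using assms by (simp add: fls_of_nat of_nat_card_choose_eq_0)
  then show ?thesis
    by (metis emb_of_nat emb_0)
qed

lemma frobenius_power_add:
  fixes a b :: 'c
  shows "(a + b) ^ (CARD('a) ^ m) = a ^ (CARD('a) ^ m) + b ^ (CARD('a) ^ m)"
proof (induction m)
  case (Suc m)
  have "(a + b) ^ (CARD('a) ^ m * CARD('a)) =
      (a ^ (CARD('a) ^ m)) ^ CARD('a) + (b ^ (CARD('a) ^ m)) ^ CARD('a)"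
    unfolding power_mult Suc
    by (rule frobenius_add) (simp_all add: of_nat_card_choose_eq_0_completion)
  then show ?case
    by (simp add: mult.commute flip: power_mult)
qed simp

lemma frobenius_power_diff:
  fixes a b :: 'c
  shows "(a - b) ^ (CARD('a) ^ m) = a ^ (CARD('a) ^ m) - b ^ (CARD('a) ^ m)"
  using frobenius_power_add[of "a - b" b m] by (simp add: algebra_simps)

text \<open>
  The Frobenius powers \<open>q\<^sup>m\<close> are additive, so the triangle inequality bounds
  \<open>abv (a + b)\<close> by \<open>2\<close> to the power \<open>1 / q\<^sup>m\<close> times the maximum, for every \<open>m\<close>.
\<close>

lemma abv_add_le: "abv (a + b) \<le> max (abv a) (abv b)"
proof (rule ccontr)
  let ?M = "max (abv a) (abv b)"
  assume "\<not> abv (a + b) \<le> ?M"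
  then have less: "?M < abv (a + b)" by (simp only: not_le)
  have "0 \<le> ?M" by (simp add: le_max_iff_disj)
  have pow: "abv (a + b) ^ (CARD('a) ^ m) \<le> 2 * ?M ^ (CARD('a) ^ m)" for m
  proof -
    have "abv (a + b) ^ (CARD('a) ^ m) \<le> abv a ^ (CARD('a) ^ m) + abv b ^ (CARD('a) ^ m)"
      using abv_triangle[of "a ^ (CARD('a) ^ m)" "b ^ (CARD('a) ^ m)"]
      by (simp flip: abv_power frobenius_power_add)
    also have "\<dots> \<le> ?M ^ (CARD('a) ^ m) + ?M ^ (CARD('a) ^ m)"
      by (intro add_mono power_mono) auto
    finally show ?thesis by simp
  qed
  have "?M \<noteq> 0"
  proof
    assume "?M = 0"
    then show False
      using pow[of 0] less by simp
  qed
  with \<open>0 \<le> ?M\<close> have "0 < ?M" by linarith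
  define r where "r = abv (a + b) / ?M"
  have "1 < r"
    using less \<open>0 < ?M\<close> by (simp add: r_def)
  then obtain n where "2 < r ^ n"
    using real_arch_pow by blast
  also have "\<dots> \<le> r ^ (CARD('a) ^ n)"
  proof (rule power_increasing)
    have "1 < CARD('a)"
      by (rule one_less_card_field)
    then show "n \<le> CARD('a) ^ n"
      using power_gt_expt[of "CARD('a)" n] by simp
  qed (use \<open>1 < r\<close> in simp)
  also have "\<dots> \<le> 2"
    using pow[of n] \<open>0 < ?M\<close> by (simp add: r_def power_divide divide_le_eq)
  finally show False by simp
qed

lemma abv_diff_le: "abv (a - b) \<le> max (abv a) (abv b)"
  using abv_add_le[of a "- b"] by simp

lemma abv_sum_le:
  assumes "\<And>i. i \<in> A \<Longrightarrow> abv (f i) \<le> B" "0 \<le> B"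
  shows "abv (sum f A) \<le> B"
  using assms
proof (induction A rule: infinite_finite_induct)
  case (insert x A)
  then have "abv (f x) \<le> B" "abv (sum f A) \<le> B" by auto
  then show ?case
    using insert.hyps abv_add_le[of "f x" "sum f A"] by simp
qed simp_all

lemma tendsto_iff_abv:
  fixes f :: "_ \<Rightarrow> 'c"
  shows "(f \<longlongrightarrow> l) F \<longleftrightarrow> ((\<lambda>n. abv (f n - l)) \<longlongrightarrow> 0) F"
  by (subst tendsto_dist_iff) (simp add: dist_abv)

lemma tendsto_abv:
  fixes f :: "_ \<Rightarrow> 'c"
  shows "(f \<longlongrightarrow> l) F \<Longrightarrow> ((\<lambda>n. abv (f n)) \<longlongrightarrow> abv l) F"
  unfolding abv_eq_dist by (intro tendsto_dist tendsto_const)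

text \<open>On \<open>'c\<close> arithmetic and metric are linked by the absolute value, so
  continuity of subtraction is derived from the ultrametric inequality.\<close>

lemma tendsto_diff_abv:
  fixes f g :: "_ \<Rightarrow> 'c"
  assumes "(f \<longlongrightarrow> l) F" "(g \<longlongrightarrow> m) F"
  shows "((\<lambda>n. f n - g n) \<longlongrightarrow> l - m) F"
  unfolding tendsto_iff_abv
proof (rule tendsto_sandwich[where f = "\<lambda>_. 0" and h = "\<lambda>n. max (abv (f n - l)) (abv (g n - m))"])
  show "\<forall>\<^sub>F n in F. abv (f n - g n - (l - m)) \<le> max (abv (f n - l)) (abv (g n - m))"
  proof (intro always_eventually allI)
    fix n
    show "abv (f n - g n - (l - m)) \<le> max (abv (f n - l)) (abv (g n - m))"
      using abv_diff_le[of "f n - l" "g n - m"] by (simp add: algebra_simps)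
  qed
  have "((\<lambda>n. max (abv (f n - l)) (abv (g n - m))) \<longlongrightarrow> max 0 0) F"
    using assms unfolding tendsto_iff_abv by (rule tendsto_max)
  then show "((\<lambda>n. max (abv (f n - l)) (abv (g n - m))) \<longlongrightarrow> 0) F"
    by simp
qed auto

lemma tendsto_mult_left_abv:
  fixes f :: "_ \<Rightarrow> 'c"
  assumes "(f \<longlongrightarrow> l) F"
  shows "((\<lambda>n. a * f n) \<longlongrightarrow> a * l) F"
proof -
  have "((\<lambda>n. abv a * abv (f n - l)) \<longlongrightarrow> abv a * 0) F"
    using assms unfolding tendsto_iff_abv by (rule tendsto_mult_left)
  then show ?thesis
    unfolding tendsto_iff_abv by (simp flip: abv_mult right_diff_distrib)
qed

lemma abv_limit_le:
  fixes f :: "_ \<Rightarrow> 'c"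
  assumes "f \<longlonglongrightarrow> l" "\<And>n. abv (f n) \<le> B"
  shows "abv l \<le> B"
  using LIMSEQ_le_const2[OF tendsto_abv[OF assms(1)]] assms(2) by blast

section \<open>Difference operators applied to Carlitz expansions\<close>

text \<open>Additivity of the power q^k turns the next difference into (f_(j+1)(x t) - x
  f_(j+1)(t))^(q^k), which is f_j(t)^(q^(k+1)). Once f_0(t) = t is reached, the result t^(q^k) is
  annihilated by the next operator.\<close>

lemma diff_op_carlitz_f:
  "diff_op \<iota> k (\<lambda>t. emb \<iota> (carlitz_f n t)) t =
    (if n < k then 0 else emb \<iota> (carlitz_f (n - k) t) ^ (CARD('a) ^ k))"
proof (induction k arbitrary: t)
  case (Suc k)
  consider "n < k" | "n = k" | j where "n = Suc (k + j)"
    by (metis less_imp_Suc_add linorder_neqE_nat)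
  then show ?case
  proof cases
    case 3
    let ?Q = "CARD('a) ^ k"
    have "diff_op \<iota> (Suc k) (\<lambda>t. emb \<iota> (carlitz_f n t)) t =
        (emb \<iota> (carlitz_f (Suc j) (fls_X * t)) - emb \<iota> (fls_X * carlitz_f (Suc j) t)) ^ ?Q"
      using 3 Suc by (simp add: frobenius_power_diff emb_mult power_mult_distrib)
    also have "\<dots> = emb \<iota> (carlitz_f j t ^ CARD('a)) ^ ?Q"
      by (simp add: carlitz_f_Suc_X_mult flip: emb_diff)
    finally show ?thesis
      using 3 by (simp add: emb_power power_mult)
  next
    case 2
    then show ?thesis
      using Suc[of t] Suc[of "fls_X * t"] by (simp add: emb_mult power_mult_distrib)
  qed (simp add: Suc)
qed simp

lemma diff_op_sum:
  "diff_op \<iota> k (\<lambda>t. \<Sum>n\<in>A. c n * F n t) t = (\<Sum>n\<in>A. c n * diff_op \<iota> k (F n) t)"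
  by (induction k arbitrary: t)
     (simp_all add: sum_distrib_left sum_subtractf right_diff_distrib mult.left_commute)

lemma diff_op_tendsto:
  assumes "\<And>t. t \<in> fls_integers \<Longrightarrow> (\<lambda>N. F N t) \<longlonglongrightarrow> u t" "t \<in> fls_integers"
  shows "(\<lambda>N. diff_op \<iota> k (F N) t) \<longlonglongrightarrow> diff_op \<iota> k u t"
  using assms(2)
proof (induction k arbitrary: t)
  case (Suc k)
  then show ?case
    using Suc.IH[OF fls_integers_mult[OF fls_integers_X Suc.prems]]
    by (auto intro!: tendsto_diff_abv tendsto_mult_left_abv)
qed (simp add: assms)

lemma diff_op_expansion:
  assumes "carlitz_expansion \<iota> u c" "t \<in> fls_integers"
  shows "(\<lambda>N. \<Sum>n<N. c (n + k) * emb \<iota> (carlitz_f n t) ^ (CARD('a) ^ k)) \<longlonglongrightarrow> diff_op \<iota> k u t"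
proof -
  have "(\<lambda>N. \<Sum>n<N. c n * emb \<iota> (carlitz_f n t)) \<longlonglongrightarrow> u t" if "t \<in> fls_integers" for t
    by (rule tendsto_uniform_limitI) (use assms(1) that in \<open>auto simp: carlitz_expansion_def\<close>)
  from diff_op_tendsto[OF this assms(2), where k = k]
  have "(\<lambda>N. \<Sum>n<N. c n * diff_op \<iota> k (\<lambda>t. emb \<iota> (carlitz_f n t)) t) \<longlonglongrightarrow> diff_op \<iota> k u t"
    by (simp add: diff_op_sum)
  \<comment> \<open>The first \<open>k\<close> summands are annihilated, so \<open>N + k\<close>
    summands leave exactly \<open>N\<close> after the index shift.\<close>
  from LIMSEQ_ignore_initial_segment[OF this, of k]
  have "(\<lambda>N. \<Sum>n<N + k. c n * diff_op \<iota> k (\<lambda>t. emb \<iota> (carlitz_f n t)) t) \<longlonglongrightarrow> diff_op \<iota> k u t" .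
  moreover have "(\<Sum>n<N + k. c n * diff_op \<iota> k (\<lambda>t. emb \<iota> (carlitz_f n t)) t) =
      (\<Sum>n<N. c (n + k) * emb \<iota> (carlitz_f n t) ^ (CARD('a) ^ k))" for N
  proof -
    have "(\<Sum>n<N + k. c n * diff_op \<iota> k (\<lambda>t. emb \<iota> (carlitz_f n t)) t) =
        (\<Sum>n\<in>{k..<N + k}. c n * diff_op \<iota> k (\<lambda>t. emb \<iota> (carlitz_f n t)) t)"
      by (intro sum.mono_neutral_right) (auto simp: diff_op_carlitz_f)
    also have "\<dots> = (\<Sum>n<N. c (n + k) * diff_op \<iota> k (\<lambda>t. emb \<iota> (carlitz_f (n + k) t)) t)"
      using sum.shift_bounds_nat_ivl[of _ 0 k N] by (simp add: atLeast0LessThan)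
    finally show ?thesis
      by (simp add: diff_op_carlitz_f)
  qed
  ultimately show ?thesis by simp
qed

lemma diff_op_at_1:
  assumes "carlitz_expansion \<iota> u c"
  shows "diff_op \<iota> k u 1 = c k"
proof -
  \<comment> \<open>At 1 only f_0 is nonzero. The range is \<open>Suc N\<close> because the empty
    sum would miss that term.\<close>
  have eq: "(\<Sum>n<Suc N. c (n + k) * emb \<iota> (carlitz_f n 1) ^ (CARD('a) ^ k)) = c k" for N
  proof -
    have "carlitz_f (Suc n) 1 = (0 :: 'a fls)" for n
      using carlitz_f_Suc_const[of n "1 :: 'a"] by simp
    then show ?thesis
      by (simp add: sum.lessThan_Suc_shift power_0_left del: sum.lessThan_Suc)
  qed
  then have "(\<lambda>N. \<Sum>n<N. c (n + k) * emb \<iota> (carlitz_f n 1) ^ (CARD('a) ^ k)) \<longlonglongrightarrow> c k"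
    by (subst filterlim_sequentially_Suc [symmetric]) (simp only: eq tendsto_const)
  then show ?thesis
    using diff_op_expansion[OF assms fls_integers_1] LIMSEQ_unique by blast
qed


section \<open>Extended difference quotients and the array of scaled differences\<close>

text \<open>Continuity of the extension enters the later estimates through this limit.\<close>

lemma extension_tendsto_at_0:
  assumes "extends_diff_quot \<iota> k u g"
  shows "(\<lambda>m. g (fls_X ^ m)) \<longlonglongrightarrow> g 0"
proof (rule continuous_on_tendsto_compose[where f = g and g = "\<lambda>m. fls_X ^ m"])
  show "continuous_on fls_integers g"
    using assms by (simp add: extends_diff_quot_def)
  show "(\<lambda>m. fls_X ^ m :: 'a fls) \<longlonglongrightarrow> 0"
    using fls_abs_X_power_tendsto_0 by (simp add: tendsto_fls_iff_abs)
qed (simp_all add: fls_integers_power)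

lemma diff_op_eq_extension:
  assumes "extends_diff_quot \<iota> k u g" "t \<in> fls_integers" "t \<noteq> 0"
  shows "diff_op \<iota> k u t = emb \<iota> t ^ (CARD('a) ^ k) * g t"
  using assms by (simp add: extends_diff_quot_def diff_quot_def)

text \<open>This is the array A. The part q^(m q^k) of the weight compensates |x^m|^(q^k) in the
  difference quotient; the part q^(i q^k) is the weight of the coefficient c_(k+i).\<close>

definition scaled_diff :: "nat \<Rightarrow> ('a fls \<Rightarrow> 'c) \<Rightarrow> nat \<Rightarrow> nat \<Rightarrow> real" where
  "scaled_diff k u i m =
    abv (diff_op \<iota> (k + i) u (fls_X ^ m)) * real CARD('a) ^ ((i + m) * CARD('a) ^ k)"

lemma scaled_diff_nonneg: "0 \<le> scaled_diff k u i m"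
  by (simp add: scaled_diff_def)

text \<open>The first alternative keeps i + m + 1 and hence its weight. In the second, the factor
  x^(q^(k+i)) contributes q^(-q^(k+i)) and the larger weight q^(q^k). For \<open>i = 0\<close> these
  cancel, so no gain arises on leaving row 0.\<close>

lemma scaled_diff_Suc_le:
  "scaled_diff k u (Suc i) m \<le>
    max (scaled_diff k u i (Suc m)) (scaled_diff k u i m / real CARD('a) ^ (CARD('a) ^ (k + i) - CARD('a) ^ k))"
proof -
  let ?q = "real CARD('a)" and ?Q = "CARD('a) ^ k" and ?P = "CARD('a) ^ (k + i)"
  let ?d = "\<lambda>m. diff_op \<iota> (k + i) u (fls_X ^ m)"
  have q: "1 < ?q"
    using one_less_card_field[where 'a = 'a] by simp
  have "?Q \<le> ?P"
    by (intro power_increasing) (auto simp: Suc_leI)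
  then have P: "?q ^ ?P = ?q ^ (?P - ?Q) * ?q ^ ?Q"
    by (simp flip: power_add)
  have "abv (diff_op \<iota> (k + Suc i) u (fls_X ^ m)) \<le> max (abv (?d (Suc m))) (abv (?d m) / ?q ^ ?P)"
    using abv_diff_le[of "?d (Suc m)" "emb \<iota> fls_X ^ ?P * ?d m"]
    by (simp add: abv_mult abv_power abv_emb fls_abs_X power_divide)
  then have "scaled_diff k u (Suc i) m \<le>
      max (abv (?d (Suc m))) (abv (?d m) / ?q ^ ?P) * ?q ^ ((Suc i + m) * ?Q)"
    unfolding scaled_diff_def by (rule mult_right_mono) simp
  also have "\<dots> = max (abv (?d (Suc m)) * ?q ^ ((Suc i + m) * ?Q))
      (abv (?d m) / ?q ^ ?P * ?q ^ ((Suc i + m) * ?Q))"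
    by (simp add: max_mult_distrib_right)
  also have "abv (?d m) / ?q ^ ?P * ?q ^ ((Suc i + m) * ?Q) = scaled_diff k u i m / ?q ^ (?P - ?Q)"
    using q unfolding P by (simp add: scaled_diff_def power_add)
  also have "abv (?d (Suc m)) * ?q ^ ((Suc i + m) * ?Q) = scaled_diff k u i (Suc m)"
    by (simp add: scaled_diff_def)
  finally show ?thesis .
qed

lemma scaled_diff_0:
  assumes "extends_diff_quot \<iota> k u g"
  shows "scaled_diff k u 0 m = abv (g (fls_X ^ m))"
  using diff_op_eq_extension[OF assms, of "fls_X ^ m"]
  by (simp add: scaled_diff_def fls_integers_power abv_mult abv_power abv_emb fls_abs_power
      fls_abs_X power_divide flip: power_mult)

text \<open>Both terms of the (k+1)-st difference at x^m carry the factor x^((m+1) q^k), which the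
  weight cancels.\<close>

lemma scaled_diff_1:
  assumes "extends_diff_quot \<iota> k u g"
  shows "scaled_diff k u 1 m = abv (g (fls_X ^ Suc m) - g (fls_X ^ m))"
proof -
  have "diff_op \<iota> (Suc k) u (fls_X ^ m) =
      emb \<iota> (fls_X ^ Suc m) ^ (CARD('a) ^ k) * (g (fls_X ^ Suc m) - g (fls_X ^ m))"
    using diff_op_eq_extension[OF assms, of "fls_X ^ m"]
      diff_op_eq_extension[OF assms, of "fls_X ^ Suc m"] fls_integers_power[OF fls_integers_X, of "Suc m"]
    by (simp add: fls_integers_power emb_mult power_mult_distrib right_diff_distrib)
  then have "scaled_diff k u 1 m = fls_abs (fls_X ^ Suc m :: 'a fls) ^ (CARD('a) ^ k) *
      abv (g (fls_X ^ Suc m) - g (fls_X ^ m)) * real CARD('a) ^ (Suc m * CARD('a) ^ k)"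
    by (simp add: scaled_diff_def abv_mult abv_power abv_emb del: diff_op.simps power_Suc)
  also have "\<dots> = abv (g (fls_X ^ Suc m) - g (fls_X ^ m))"
    by (simp only: fls_abs_power fls_abs_X power_divide power_one flip: power_mult) simp
  finally show ?thesis .
qed

lemma scaled_diff_column_0:
  assumes "carlitz_expansion \<iota> u c"
  shows "scaled_diff k u i 0 = real CARD('a) ^ (i * CARD('a) ^ k) * abv (c (k + i))"
  using diff_op_at_1[OF assms] by (simp add: scaled_diff_def)

lemma extension_imp_coeff_decay:
  assumes "carlitz_expansion \<iota> u c" "extends_diff_quot \<iota> k u g"
  shows "(\<lambda>n. real CARD('a) ^ (n * CARD('a) ^ k) * abv (c n)) \<longlonglongrightarrow> 0"
proof -
  let ?q = "real CARD('a)" and ?Q = "CARD('a) ^ k"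
  have q1: "1 < CARD('a)"
    by (rule one_less_card_field)
  then have q: "1 < ?q" by simp
  \<comment> \<open>The decay argument starts from row 1: row 0 tends to |g(0)|, which may be
    nonzero, and the step out of row 0 brings no division by q.\<close>
  have "(\<lambda>i. scaled_diff k u (Suc i) 0) \<longlonglongrightarrow> 0"
  proof (rule double_sequence_decay[where r = ?q])
    have "(\<lambda>m. g (fls_X ^ Suc m) - g (fls_X ^ m)) \<longlonglongrightarrow> g 0 - g 0"
      using extension_tendsto_at_0[OF assms(2)] by (intro tendsto_diff_abv LIMSEQ_Suc)
    moreover have "scaled_diff k u (Suc 0) = (\<lambda>m. abv (g (fls_X ^ Suc m) - g (fls_X ^ m)))"
      using scaled_diff_1[OF assms(2)] by (intro ext) simp
    ultimately show "scaled_diff k u (Suc 0) \<longlonglongrightarrow> 0"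
      using tendsto_abv by fastforce
    fix i m
    have "?Q * 1 < ?Q * CARD('a) ^ Suc i"
      using q1 by (intro mult_strict_left_mono one_less_power) auto
    then have "?Q < CARD('a) ^ (k + Suc i)"
      by (simp only: power_add mult_1_right)
    then have "1 \<le> CARD('a) ^ (k + Suc i) - ?Q"
      by linarith
    then have "?q ^ 1 \<le> ?q ^ (CARD('a) ^ (k + Suc i) - ?Q)"
      using q by (intro power_increasing) auto
    then have "scaled_diff k u (Suc i) m / ?q ^ (CARD('a) ^ (k + Suc i) - ?Q) \<le>
        scaled_diff k u (Suc i) m / ?q"
      using q scaled_diff_nonneg by (intro divide_left_mono) auto
    then show "scaled_diff k u (Suc (Suc i)) m \<le>
        max (scaled_diff k u (Suc i) (Suc m)) (scaled_diff k u (Suc i) m / ?q)"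
      using scaled_diff_Suc_le[of k u "Suc i" m] by linarith
  qed (use q scaled_diff_nonneg in auto)
  \<comment> \<open>Column 0 weights c_(k+i) by q^(i q^k); the factor q^(k q^k) restores the weight
    belonging to the index k + i.\<close>
  then have "(\<lambda>i. ?q ^ (k * ?Q) * scaled_diff k u (Suc i) 0) \<longlonglongrightarrow> ?q ^ (k * ?Q) * 0"
    by (rule tendsto_mult_left)
  then have "(\<lambda>i. ?q ^ ((i + Suc k) * ?Q) * abv (c (i + Suc k))) \<longlonglongrightarrow> 0"
    by (simp add: scaled_diff_column_0[OF assms(1)] algebra_simps power_add)
  then show ?thesis
    by (rule LIMSEQ_offset)
qed

text \<open>The bound passes from row 0 to all rows, since the divisor in
  \<open>scaled_diff_Suc_le\<close> is at least 1. Only the points x^m are mentioned because there a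
  bound is available from convergence alone.\<close>

lemma coeff_le_extension_bound:
  assumes "carlitz_expansion \<iota> u c" "extends_diff_quot \<iota> k u g"
    and "\<And>m. abv (g (fls_X ^ m)) \<le> b"
  shows "real CARD('a) ^ (i * CARD('a) ^ k) * abv (c (k + i)) \<le> b"
proof -
  have "scaled_diff k u i m \<le> b" for m
  proof (induction i arbitrary: m)
    case 0
    then show ?case
      using assms(3) by (simp add: scaled_diff_0[OF assms(2)])
  next
    case (Suc i)
    let ?r = "real CARD('a) ^ (CARD('a) ^ (k + i) - CARD('a) ^ k)"
    have "1 \<le> ?r"
      using one_less_card_field[where 'a = 'a] by (intro one_le_power) simp
    then have "scaled_diff k u i m / ?r \<le> scaled_diff k u i m"
      using scaled_diff_nonneg[of k u i m] by (simp add: divide_le_eq mult_left_le_one_le mult_le_cancel_left1)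
    then show ?case
      using scaled_diff_Suc_le[of k u i m] Suc[of m] Suc[of "Suc m"] by linarith
  qed
  then show ?thesis
    by (simp flip: scaled_diff_column_0[OF assms(1)])
qed

text \<open>For nonzero \<open>t\<close> the linear bound on f_n(t) estimates every summand of the
  k-th difference by b |t|^(q^k), and |t|^(q^k) cancels against the difference quotient. The value
  at 0 is the limit along x^m.\<close>

lemma extension_le_coeff_bound:
  assumes "carlitz_expansion \<iota> u c" "extends_diff_quot \<iota> k u g" "t \<in> fls_integers"
    and bound: "\<And>i. real CARD('a) ^ (i * CARD('a) ^ k) * abv (c (k + i)) \<le> b"
  shows "abv (g t) \<le> b"
proof -
  let ?q = "real CARD('a)" and ?Q = "CARD('a) ^ k"
  have "0 \<le> b"
    using bound[of 0] by (simp add: order_trans[OF abv_nonneg])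
  have nz: "abv (g t) \<le> b" if t: "t \<in> fls_integers" "t \<noteq> 0" for t
  proof -
    have "abv (diff_op \<iota> k u t) \<le> b * fls_abs t ^ ?Q"
    proof (rule abv_limit_le[OF diff_op_expansion[OF assms(1) t(1)]], rule abv_sum_le)
      fix n
      have "abv (c (n + k) * emb \<iota> (carlitz_f n t) ^ ?Q) \<le> abv (c (n + k)) * (?q ^ n * fls_abs t) ^ ?Q"
        using fls_abs_carlitz_f_le[OF t(1), of n]
        by (auto simp: abv_mult abv_power abv_emb intro!: mult_left_mono power_mono)
      also have "\<dots> = (?q ^ (n * ?Q) * abv (c (k + n))) * fls_abs t ^ ?Q"
        by (simp add: power_mult_distrib power_mult add.commute)
      also have "\<dots> \<le> b * fls_abs t ^ ?Q"
        by (intro mult_right_mono bound) simp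
      finally show "abv (c (n + k) * emb \<iota> (carlitz_f n t) ^ ?Q) \<le> b * fls_abs t ^ ?Q" .
    qed (use \<open>0 \<le> b\<close> in simp)
    moreover have "abv (diff_op \<iota> k u t) = fls_abs t ^ ?Q * abv (g t)"
      using diff_op_eq_extension[OF assms(2) t] by (simp add: abv_mult abv_power abv_emb)
    ultimately have "fls_abs t ^ ?Q * abv (g t) \<le> fls_abs t ^ ?Q * b"
      by (simp add: mult.commute[of b])
    moreover have "0 < fls_abs t ^ ?Q"
      using t(2) by (intro zero_less_power fls_abs_pos)
    ultimately show ?thesis
      by (simp only: mult_le_cancel_left_pos)
  qed
  have "abv (g 0) \<le> b"
    by (rule abv_limit_le[OF extension_tendsto_at_0[OF assms(2)]]) (simp add: nz fls_integers_power)
  then show ?thesis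
    using nz assms(3) by (cases "t = 0") auto
qed

section \<open>Construction of the extension from decaying coefficients\<close>

lemma lipschitz_imp_continuous_on:
  fixes h :: "'a fls \<Rightarrow> 'c"
  assumes "\<And>s t. s \<in> fls_integers \<Longrightarrow> t \<in> fls_integers \<Longrightarrow> abv (h s - h t) \<le> C * fls_abs (s - t)"
  shows "continuous_on fls_integers h"
  unfolding continuous_on_def
proof
  fix t :: "'a fls"
  assume t: "t \<in> fls_integers"
  have "((\<lambda>s. s) \<longlongrightarrow> t) (at t within fls_integers)"
    by (rule tendsto_ident_at)
  then have "((\<lambda>s. C * fls_abs (s - t)) \<longlongrightarrow> C * 0) (at t within fls_integers)"
    unfolding tendsto_fls_iff_abs by (rule tendsto_mult_left)
  then have lim: "((\<lambda>s. C * fls_abs (s - t)) \<longlongrightarrow> 0) (at t within fls_integers)"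
    by simp
  show "(h \<longlongrightarrow> h t) (at t within fls_integers)"
    unfolding tendsto_iff_abv
    by (rule tendsto_sandwich[OF _ _ tendsto_const lim])
       (use assms t in \<open>auto simp: eventually_at_topological\<close>)
qed

lemma coeff_decay_imp_extension:
  assumes "carlitz_expansion \<iota> u c"
    and decay: "(\<lambda>n. real CARD('a) ^ (n * CARD('a) ^ k) * abv (c n)) \<longlonglongrightarrow> 0"
  obtains g where "extends_diff_quot \<iota> k u g"
proof -
  let ?q = "real CARD('a)" and ?Q = "CARD('a) ^ k"
  have q: "1 < ?q"
    using one_less_card_field[where 'a = 'a] by simp
  \<comment> \<open>These are the summands of the k-th difference divided by t^(q^k), in a form that
    makes sense at t = 0 as well.\<close>
  define T where "T n t = c (n + k) * emb \<iota> (carlitz_phi n t) ^ ?Q" for n t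
  define G where "G N t = (\<Sum>n<N. T n t)" for N t
  \<comment> \<open>The estimate of \<open>carlitz_phi\<close> gives the exponent n q^k. It is
    enlarged to (n + k) q^k to match the sequence in \<open>decay\<close>, at index n + k.\<close>
  have T_le: "abv (T n t) \<le> ?q ^ ((n + k) * ?Q) * abv (c (n + k))" if "t \<in> fls_integers" for n t
  proof -
    have "abv (T n t) \<le> abv (c (n + k)) * (?q ^ n) ^ ?Q"
      using fls_abs_carlitz_phi_le[OF that, of n]
      by (auto simp: T_def abv_mult abv_power abv_emb intro!: mult_left_mono power_mono)
    also have "\<dots> \<le> abv (c (n + k)) * ?q ^ ((n + k) * ?Q)"
      unfolding power_mult [symmetric]
      using q by (intro mult_left_mono power_increasing) auto
    finally show ?thesis by (simp add: mult.commute)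
  qed
  \<comment> \<open>In an ultrametric space uniformly small summands already make the partial sums
    uniformly Cauchy.\<close>
  have "uniformly_convergent_on fls_integers G"
  proof (rule Cauchy_uniformly_convergent, rule uniformly_Cauchy_onI')
    fix e :: real
    assume "0 < e"
    then obtain N where N: "\<And>n. n \<ge> N \<Longrightarrow> ?q ^ (n * ?Q) * abv (c n) < e / 2"
      using LIMSEQ_D[OF decay, of "e / 2"] by (auto simp: abv_mult)
    have "dist (G m t) (G n t) < e" if "t \<in> fls_integers" "m \<ge> N" "n > m" for t m n
    proof -
      have "G n t - G m t = sum (\<lambda>n. T n t) {m..<n}"
        using sum_diff_nat_ivl[of 0 m n "\<lambda>n. T n t"] that(3) by (simp add: G_def atLeast0LessThan)
      moreover have "abv (sum (\<lambda>n. T n t) {m..<n}) \<le> e / 2"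
      proof (rule abv_sum_le)
        fix i assume "i \<in> {m..<n}"
        then show "abv (T i t) \<le> e / 2"
          using T_le[OF that(1), of i] N[of "i + k"] that(2) by simp
      qed (use \<open>0 < e\<close> in simp)
      ultimately have "dist (G n t) (G m t) \<le> e / 2"
        by (simp add: dist_abv)
      then show ?thesis
        using \<open>0 < e\<close> by (simp add: dist_commute)
    qed
    then show "\<exists>M. \<forall>t\<in>fls_integers. \<forall>m\<ge>M. \<forall>n>m. dist (G m t) (G n t) < e"
      by blast
  qed
  then obtain g where g: "uniform_limit fls_integers G g sequentially"
    by (auto simp: uniformly_convergent_on_def)
  have "continuous_on fls_integers (G N)" for N
  proof (rule lipschitz_imp_continuous_on)
    let ?C = "\<lambda>n. abv (c (n + k)) * fls_abs (inverse (carlitz_D n :: 'a fls)) ^ ?Q"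
    fix s t :: "'a fls"
    assume st: "s \<in> fls_integers" "t \<in> fls_integers"
    have "abv (G N s - G N t) = abv (\<Sum>n<N. T n s - T n t)"
      by (simp add: G_def sum_subtractf)
    also have "\<dots> \<le> (\<Sum>n<N. ?C n) * fls_abs (s - t)"
    proof (rule abv_sum_le)
      fix n assume n: "n \<in> {..<N}"
      have "T n s - T n t = c (n + k) * emb \<iota> (carlitz_phi n s ^ ?Q - carlitz_phi n t ^ ?Q)"
        by (simp add: T_def emb_diff emb_power right_diff_distrib)
      then have "abv (T n s - T n t) \<le> ?C n * fls_abs (s - t)"
        using mult_left_mono[OF carlitz_phi_power_lipschitz[OF st, of n ?Q], of "abv (c (n + k))"]
        by (simp add: abv_mult abv_emb mult.assoc)
      also have "\<dots> \<le> (\<Sum>n<N. ?C n) * fls_abs (s - t)"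
        using n by (intro mult_right_mono member_le_sum) auto
      finally show "abv (T n s - T n t) \<le> (\<Sum>n<N. ?C n) * fls_abs (s - t)" .
    qed (intro mult_nonneg_nonneg sum_nonneg, auto)
    finally show "abv (G N s - G N t) \<le> (\<Sum>n<N. ?C n) * fls_abs (s - t)" .
  qed
  then have "continuous_on fls_integers g"
    using g by (intro uniform_limit_theorem[OF _ g]) auto
  moreover have "g t = diff_quot \<iota> k u t" if "t \<in> fls_integers - {0}" for t
  proof (rule LIMSEQ_unique)
    show "(\<lambda>N. G N t) \<longlonglongrightarrow> g t"
      by (rule tendsto_uniform_limitI[OF g]) (use that in simp)
    have "G N t = inverse (emb \<iota> t ^ ?Q) * (\<Sum>n<N. c (n + k) * emb \<iota> (carlitz_f n t) ^ ?Q)" for N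
      using that
      by (simp add: G_def T_def carlitz_f_eq_mult_phi emb_mult power_mult_distrib sum_distrib_left field_simps)
    moreover have "(\<lambda>N. inverse (emb \<iota> t ^ ?Q) * (\<Sum>n<N. c (n + k) * emb \<iota> (carlitz_f n t) ^ ?Q))
        \<longlonglongrightarrow> diff_quot \<iota> k u t"
      unfolding diff_quot_def
      by (intro tendsto_mult_left_abv diff_op_expansion[OF assms(1)]) (use that in simp)
    ultimately show "(\<lambda>N. G N t) \<longlonglongrightarrow> diff_quot \<iota> k u t"
      by simp
  qed
  ultimately show ?thesis
    by (intro that) (auto simp: extends_diff_quot_def)
qed

section \<open>The supremum formula and the theorem\<close>

lemma SUP_extension_eq:
  assumes "carlitz_expansion \<iota> u c" "extends_diff_quot \<iota> k u g"
  shows "(SUP t\<in>fls_integers. abv (g t)) =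
    (SUP n\<in>{k..}. real CARD('a) ^ ((n - k) * CARD('a) ^ k) * abv (c n))"
proof -
  let ?q = "real CARD('a)" and ?Q = "CARD('a) ^ k"
  have "(SUP t\<in>fls_integers. abv (g t)) = (SUP i. ?q ^ (i * ?Q) * abv (c (k + i)))" (is "_ = ?S")
  proof -
    \<comment> \<open>Real suprema require boundedness first. Convergence along x^m bounds |g(x^m)|,
      this bounds the weighted coefficients, and their supremum then bounds \<open>g\<close> on all
      of O.\<close>
    have "Bseq (\<lambda>m. abv (g (fls_X ^ m)))"
      using tendsto_abv[OF extension_tendsto_at_0[OF assms(2)]] by (intro convergent_imp_Bseq convergentI)
    then obtain b where "\<forall>m. norm (abv (g (fls_X ^ m))) \<le> b"
      by (rule BseqE)
    then have "abv (g (fls_X ^ m)) \<le> b" for m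
      by simp
    note coeff_le_extension_bound[OF assms this]
    then have "bdd_above (range (\<lambda>i. ?q ^ (i * ?Q) * abv (c (k + i))))"
      by (intro bdd_aboveI2)
    then have le_S: "?q ^ (i * ?Q) * abv (c (k + i)) \<le> ?S" for i
      by (intro cSUP_upper) auto
    have g_le_S: "abv (g t) \<le> ?S" if "t \<in> fls_integers" for t
      using extension_le_coeff_bound[OF assms that le_S] .
    then have bdd: "bdd_above ((\<lambda>t. abv (g t)) ` fls_integers)"
      by (intro bdd_aboveI2)
    show ?thesis
    proof (rule antisym)
      show "(SUP t\<in>fls_integers. abv (g t)) \<le> ?S"
        using fls_integers_0 by (intro cSUP_least g_le_S) blast+
      have "abv (g (fls_X ^ m)) \<le> (SUP t\<in>fls_integers. abv (g t))" for m
        by (intro cSUP_upper bdd fls_integers_power) simp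
      then show "?S \<le> (SUP t\<in>fls_integers. abv (g t))"
        by (intro cSUP_least coeff_le_extension_bound[OF assms]) auto
    qed
  qed
  moreover have "{k..} = range (\<lambda>i. k + i)"
    by (auto simp: image_iff le_iff_add)
  then have "range (\<lambda>i. ?q ^ (i * ?Q) * abv (c (k + i))) =
      (\<lambda>n. ?q ^ ((n - k) * ?Q) * abv (c n)) ` {k..}"
    by (simp add: image_image)
  ultimately show ?thesis by simp
qed

end

theorem theorem2:
  fixes \<iota> :: "'a::{field,finite} fls alg_closure \<Rightarrow> 'c::{field,complete_space}"
    and abv :: "'c \<Rightarrow> real"
    and u :: "'a fls \<Rightarrow> 'c" and c :: "nat \<Rightarrow> 'c" and k :: nat
  assumes "completed_alg_closure \<iota> abv"
    and "u \<in> C0 \<iota>"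
    and "carlitz_expansion \<iota> u c"
  shows "(u \<in> C0_Suc \<iota> k \<longleftrightarrow>
            (\<lambda>n. real CARD('a) ^ (n * CARD('a) ^ k) * abv (c n)) \<longlonglongrightarrow> 0) \<and>
         (u \<in> C0_Suc \<iota> k \<longrightarrow>
            (\<forall>g. extends_diff_quot \<iota> k u g \<longrightarrow>
               (SUP t\<in>fls_integers. abv (g t)) =
               (SUP n\<in>{k..}. real CARD('a) ^ ((n - k) * CARD('a) ^ k) * abv (c n))))"
proof -
  interpret completed_alg_closure \<iota> abv by fact
  have "u \<in> C0_Suc \<iota> k \<longleftrightarrow> (\<exists>g. extends_diff_quot \<iota> k u g)"
    using assms(2) by (simp add: C0_Suc_def)
  also have "\<dots> \<longleftrightarrow> (\<lambda>n. real CARD('a) ^ (n * CARD('a) ^ k) * abv (c n)) \<longlonglongrightarrow> 0"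
    using extension_imp_coeff_decay[OF assms(3)] coeff_decay_imp_extension[OF assms(3)] by metis
  finally show ?thesis
    using SUP_extension_eq[OF assms(3)] by simp
qed

end
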